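(* Let $\omega$ be an admissible weight on $\mathbb{N}$, let $\mathcal{A}$ be a commutative unital complex Banach algebra, and let $f\in\mathcal{D}(\mathbb{N},\omega,\mathcal{A})$. Then $f$ is invertible in $\mathcal{D}(\mathbb{N},\omega,\mathcal{A})$ if and only if $\overline{\{f(s):s\in\mathcal H\}}\subset G(\mathcal{A})$ (closure in $\mathcal A$).
   Context: $\mathcal{H}=\{s\in\mathbb C:\operatorname{Re}s\geq 0\}$; $G(\mathcal A)$ is the set of invertible elements of $\mathcal A$. A weight on $\mathbb N$ (as a multiplicative semigroup, equivalently on $\log\mathbb N$) is a map $\omega:\mathbb N\to[1,\infty)$ with $\omega(1)=1$ and $\omega(mn)\le\omega(m)\omega(n)$ for all $m,n$; it is admissible if $\lim_{k\to\infty}\omega(n^k)^{1/k}=1$ for all $n\in\mathbb N$. $\mathcal D(\mathbb N,\omega,\mathcal A)$ is the set of functions $f:\mathcal H\to\mathcal A$ of the form $f(s)=\sum_{n\in\mathbb N}f_n n^{-s}$ with $f_n\in\mathcal A$ and $\|f\|_\omega=\sum_n\|f_n\|\omega(n)<\infty$; it is a unital Banach algebra under pointwise multiplication and $\|\cdot\|_\omega$. *)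

theory Defs
  imports "HOL-Analysis.Analysis"
begin

class comm_complex_banach_algebra_1 = real_normed_algebra_1 + banach + comm_ring_1 +
  fixes scaleC :: "complex \<Rightarrow> 'a \<Rightarrow> 'a"
  assumes scaleC_add_right: "scaleC a (x + y) = scaleC a x + scaleC a y"
    and scaleC_add_left: "scaleC (a + b) x = scaleC a x + scaleC b x"
    and scaleC_scaleC: "scaleC a (scaleC b x) = scaleC (a * b) x"
    and scaleC_one: "scaleC 1 x = x"
    and scaleR_scaleC: "scaleR r x = scaleC (complex_of_real r) x"
    and norm_scaleC: "norm (scaleC a x) = cmod a * norm x"
    and scaleC_mult_left: "scaleC a x * y = scaleC a (x * y)"

instantiation complex :: comm_complex_banach_algebra_1
begin
definition scaleC_complex :: "complex \<Rightarrow> complex \<Rightarrow> complex" where "scaleC_complex a x = a * x"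
instance by standard (auto simp: scaleC_complex_def algebra_simps norm_mult scaleR_conv_of_real)
end

text \<open>Weights on the multiplicative semigroup \<open>\<nat> = {1,2,...}\<close> (values at 0 irrelevant).\<close>
definition weight_on_N :: "(nat \<Rightarrow> real) \<Rightarrow> bool" where
  "weight_on_N \<omega> \<longleftrightarrow> \<omega> 1 = 1 \<and> (\<forall>n\<ge>1. \<omega> n \<ge> 1) \<and>
     (\<forall>m n. m \<ge> 1 \<longrightarrow> n \<ge> 1 \<longrightarrow> \<omega> (m * n) \<le> \<omega> m * \<omega> n)"

definition admissible_weight :: "(nat \<Rightarrow> real) \<Rightarrow> bool" where
  "admissible_weight \<omega> \<longleftrightarrow> weight_on_N \<omega> \<and>
     (\<forall>n\<ge>1. (\<lambda>k. \<omega> (n ^ k) powr (1 / real k)) \<longlonglongrightarrow> 1)"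

definition right_half_plane :: "complex set" where
  "right_half_plane = {s. Re s \<ge> 0}"

text \<open>The algebra \<open>D(\<nat>, \<omega>, A)\<close>: functions on \<open>\<H>\<close> (values off \<open>\<H>\<close> ignored)
  of the form \<open>f(s) = \<Sum>\<^sub>n f\<^sub>n n\<^sup>-\<^sup>s\<close> with \<open>\<Sum>\<^sub>n \<parallel>f\<^sub>n\<parallel> \<omega>(n) < \<infinity>\<close>.\<close>
definition dirichlet_algebra :: "(nat \<Rightarrow> real) \<Rightarrow> (complex \<Rightarrow> 'a::comm_complex_banach_algebra_1) set" where
  "dirichlet_algebra \<omega> = {f. \<exists>c :: nat \<Rightarrow> 'a.
      (\<lambda>n. norm (c n) * \<omega> n) summable_on {1..} \<and>
      (\<forall>s\<in>right_half_plane. f s = (\<Sum>\<^sub>\<infinity>n\<in>{1..}. scaleC ((of_nat n :: complex) powr (- s)) (c n)))}"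

definition invertibles :: "'a::comm_ring_1 set" where
  "invertibles = {x. \<exists>y. x * y = 1}"

definition invertible_in_D :: "(nat \<Rightarrow> real) \<Rightarrow> (complex \<Rightarrow> 'a::comm_complex_banach_algebra_1) \<Rightarrow> bool" where
  "invertible_in_D \<omega> f \<longleftrightarrow> (\<exists>g \<in> dirichlet_algebra \<omega>. \<forall>s\<in>right_half_plane. f s * g s = 1)"

end

theory Submission
  imports Defs
begin

text \<open>For \<open>\<sigma> \<ge> 0\<close> let \<open>f\<^sub>\<sigma>(s) = f(s + \<sigma>)\<close>, a continuous path in the Dirichlet algebra from \<open>f\<close> to the constant
  \<open>c\<^sub>1\<close> at \<open>\<sigma> = \<infinity>\<close>. The closure of the range of \<open>f\<close> is compact, so the pointwise inverses of all \<open>f\<^sub>\<sigma>\<close> are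
  bounded by one constant \<open>M\<close>. If \<open>f\<^sub>\<sigma>\<close> has an inverse \<open>g\<close> in the algebra, then the Neumann series
  \<open>\<Sum>\<^sub>n (f\<^sub>\<sigma> - f\<^sub>\<tau>)\<^sup>n g\<^sup>n\<^sup>+\<^sup>1\<close> inverts \<open>f\<^sub>\<tau>\<close> as soon as \<open>\<parallel>f\<^sub>\<sigma> - f\<^sub>\<tau>\<parallel>\<^sub>\<omega> < 1/(M + 1)\<close>, because the spectral radius of
  \<open>g\<close> in the algebra is at most \<open>sup |g| \<le> M\<close>; hence finitely many steps lead from \<open>c\<^sub>1\<close> back to \<open>f\<close>. For the
  spectral radius, approximate \<open>g\<close> by a Dirichlet polynomial \<open>P\<close>: the coefficients of \<open>P\<^sup>j\<close> are at most
  \<open>sup |P|\<^sup>j\<close>, and by admissibility the sum of \<open>\<omega>\<close> over the frequencies of \<open>P\<^sup>j\<close> grows subexponentially.\<close>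

section \<open>Complex scalars and Dirichlet monomials\<close>

lemma scaleC_zero_right [simp]: "scaleC z (0::'a::comm_complex_banach_algebra_1) = 0"
  using scaleC_add_right[of z "0::'a" 0] by simp

lemma scaleC_mult_right:
  fixes x y :: "'a::comm_complex_banach_algebra_1"
  shows "x * scaleC z y = scaleC z (x * y)"
  by (metis mult.commute scaleC_mult_left)

lemma scaleC_mult_scaleC:
  fixes x y :: "'a::comm_complex_banach_algebra_1"
  shows "scaleC a x * scaleC b y = scaleC (a * b) (x * y)"
  by (simp add: scaleC_mult_left scaleC_mult_right scaleC_scaleC mult.commute)

lemma scaleC_zero_left [simp]: "scaleC 0 (x::'a::comm_complex_banach_algebra_1) = 0"
  using scaleC_add_left[of 0 0 x] by simp

lemma scaleC_minus_left:
  fixes x :: "'a::comm_complex_banach_algebra_1"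
  shows "scaleC (- z) x = - scaleC z x"
  using scaleC_scaleC[of z "-1" x] scaleR_scaleC[of "-1" x] scaleC_add_left[of z "-z" x]
  by (simp add: eq_neg_iff_add_eq_0 add.commute)

lemma scaleC_diff_left:
  fixes x :: "'a::comm_complex_banach_algebra_1"
  shows "scaleC (a - b) x = scaleC a x - scaleC b x"
  using scaleC_add_left[of a "-b" x] by (simp add: scaleC_minus_left)

lemma bounded_linear_scaleC_right:
  "bounded_linear (scaleC z :: 'a::comm_complex_banach_algebra_1 \<Rightarrow> 'a)"
  by (rule bounded_linear_intro[where K = "cmod z"])
    (auto simp: scaleC_add_right scaleR_scaleC scaleC_scaleC norm_scaleC mult.commute)

lemma bounded_linear_scaleC_left:
  "bounded_linear (\<lambda>z. scaleC z (x :: 'a::comm_complex_banach_algebra_1))"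
  by (rule bounded_linear_intro[where K = "norm x"])
    (auto simp: scaleC_add_left scaleR_scaleC[where 'a = 'a] scaleC_scaleC norm_scaleC scaleR_conv_of_real)

lemma scaleC_sum_right:
  fixes f :: "'i \<Rightarrow> 'a::comm_complex_banach_algebra_1"
  shows "scaleC z (sum f F) = (\<Sum>i\<in>F. scaleC z (f i))"
  by (induction F rule: infinite_finite_induct) (auto simp: scaleC_add_right)

lemma scaleC_sum_left:
  fixes x :: "'a::comm_complex_banach_algebra_1"
  shows "scaleC (sum z F) x = (\<Sum>i\<in>F. scaleC (z i) x)"
  using linear_sum[OF bounded_linear.linear[OF bounded_linear_scaleC_left[of x]]] by blast

abbreviation dmono :: "complex \<Rightarrow> nat \<Rightarrow> complex" where
  "dmono s n \<equiv> (of_nat n :: complex) powr (- s)"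

lemma dmono_mult: "dmono s (m * n) = dmono s m * dmono s n"
proof -
  have "complex_of_real (real m * real n) powr (- s)
      = complex_of_real (real m) powr (- s) * complex_of_real (real n) powr (- s)"
    using powr_times_real[of "of_real (real m)" "of_real (real n)" "-s"] by simp
  thus ?thesis by simp
qed

lemma dmono_add: "dmono (s + t) n = dmono s n * dmono t n"
  using powr_add[of "of_nat n" "-s" "-t"] by simp

lemma norm_dmono: "n \<ge> 1 \<Longrightarrow> cmod (dmono s n) = real n powr (- Re s)"
  using norm_powr_real_powr[of "of_nat n" "-s"] by simp

lemma norm_dmono_le_1:
  assumes "s \<in> right_half_plane" "n \<ge> 1"
  shows "cmod (dmono s n) \<le> 1"
  using assms powr_mono[of "- Re s" 0 "real n"] by (simp add: norm_dmono right_half_plane_def)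

section \<open>Norm bounds in the Dirichlet algebra\<close>

text \<open>A relation in place of the norm: no uniqueness of coefficients has to be proved, and
  values off the half-plane stay irrelevant. \<open>has_sum\<close> carries the convergence that
  \<open>infsum\<close> alone would not assert.\<close>

definition dir_bounded ::
  "(nat \<Rightarrow> real) \<Rightarrow> real \<Rightarrow> (complex \<Rightarrow> 'a::comm_complex_banach_algebra_1) \<Rightarrow> bool" where
  "dir_bounded \<omega> B f \<longleftrightarrow> (\<exists>c S. ((\<lambda>n. norm (c n) * \<omega> n) has_sum S) {1..} \<and> S \<le> B \<and>
     (\<forall>s\<in>right_half_plane. ((\<lambda>n. scaleC (dmono s n) (c n)) has_sum f s) {1..}))"

lemma weight_ge_1: "weight_on_N \<omega> \<Longrightarrow> n \<ge> 1 \<Longrightarrow> \<omega> n \<ge> 1"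
  by (simp add: weight_on_N_def)

lemma weight_mult: "weight_on_N \<omega> \<Longrightarrow> m \<ge> 1 \<Longrightarrow> n \<ge> 1 \<Longrightarrow> \<omega> (m * n) \<le> \<omega> m * \<omega> n"
  by (simp add: weight_on_N_def)

lemma norm_scaleC_dmono_le:
  fixes x :: "'a::comm_complex_banach_algebra_1"
  assumes w: "weight_on_N \<omega>" and s: "s \<in> right_half_plane" and n: "n \<ge> 1"
  shows "norm (scaleC (dmono s n) x) \<le> norm x * \<omega> n"
proof -
  have "cmod (dmono s n) * norm x \<le> \<omega> n * norm x"
    using norm_dmono_le_1[OF s n] weight_ge_1[OF w n] by (intro mult_right_mono) auto
  thus ?thesis by (simp add: norm_scaleC mult.commute)
qed

lemma has_sum_comparison:
  fixes f g :: "'i \<Rightarrow> real"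
  assumes "(g has_sum S) A" "\<And>x. x \<in> A \<Longrightarrow> 0 \<le> f x" "\<And>x. x \<in> A \<Longrightarrow> f x \<le> g x"
  obtains T where "(f has_sum T) A" "T \<le> S"
proof -
  have "f summable_on A"
    using summable_on_comparison_test[of g A f] assms by (auto simp: summable_on_def)
  then obtain T where T: "(f has_sum T) A"
    by (auto simp: summable_on_def)
  with has_sum_mono[OF T assms(1)] assms(3) that show thesis by blast
qed

text \<open>A series of monomials \<open>a\<^sub>i (m\<^sub>i)\<^sup>-\<^sup>s\<close> with repeated frequencies is enough: products and
  infinite sums of elements of the algebra come in this form.\<close>

lemma dir_boundedI:
  fixes a :: "'i \<Rightarrow> 'a::comm_complex_banach_algebra_1"
  assumes w: "weight_on_N \<omega>"
    and m: "\<And>i. i \<in> I \<Longrightarrow> m i \<ge> 1"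
    and b: "(b has_sum S) I" and SB: "S \<le> B"
    and ab: "\<And>i. i \<in> I \<Longrightarrow> norm (a i) * \<omega> (m i) \<le> b i"
    and f: "\<And>s. s \<in> right_half_plane \<Longrightarrow> ((\<lambda>i. scaleC (dmono s (m i)) (a i)) has_sum f s) I"
  shows "dir_bounded \<omega> B f"
proof -
  \<comment> \<open>The fibre \<open>J n\<close> collects the indices of frequency \<open>n\<close>;
    tagging each index with its frequency turns \<open>I\<close> into a \<open>Sigma\<close> set,
    over which sums can be taken fibre by fibre.\<close>
  define J where "J n = {i \<in> I. m i = n}" for n
  define h where "h i = (m i, i)" for i
  have inj: "inj_on h I" by (auto simp: inj_on_def h_def)
  have img: "h ` I = Sigma {1..} J" using m by (auto simp: h_def J_def)
  have w1: "\<omega> (m i) \<ge> 1" if "i \<in> I" for i using weight_ge_1[OF w m[OF that]] .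
  have an: "norm (a i) \<le> b i" if "i \<in> I" for i
    using ab[OF that] mult_left_mono[OF w1[OF that] norm_ge_zero[of "a i"]] by linarith
  have bS: "((\<lambda>(n,i). b i) has_sum S) (Sigma {1..} J)"
    using b has_sum_reindex[OF inj, unfolded img, of "\<lambda>(n,i). b i" S] by (simp add: o_def h_def)
  have bJ: "b summable_on J n" for n
    by (rule summable_on_subset_banach[of b I]) (use b in \<open>auto simp: J_def summable_on_def\<close>)
  have aJ: "a summable_on J n" for n
    by (rule abs_summable_summable, rule Infinite_Sum.abs_summable_on_comparison_test'[OF bJ])
      (use an in \<open>auto simp: J_def\<close>)
  define c where "c n = infsum a (J n)" for n
  define \<beta> where "\<beta> n = infsum b (J n)" for n
  have \<beta>: "(\<beta> has_sum S) {1..}"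
    by (rule has_sum_SigmaD[OF bS]) (use bJ in \<open>simp add: \<beta>_def\<close>)
  have cb: "norm (c n) * \<omega> n \<le> \<beta> n" if "n \<ge> 1" for n
  proof -
    have wn: "\<omega> n > 0" using weight_ge_1[OF w that] by linarith
    \<comment> \<open>All indices in a fibre share the weight \<open>\<omega> n\<close>, so
      \<open>ab\<close> can be divided by it before summing.\<close>
    have "norm (c n) \<le> \<beta> n * (1 / \<omega> n)"
    proof (rule norm_infsum_le)
      show "(a has_sum c n) (J n)" using aJ by (simp add: c_def)
      show "((\<lambda>i. b i * (1 / \<omega> n)) has_sum \<beta> n * (1 / \<omega> n)) (J n)"
        by (rule has_sum_cmult_left) (use bJ in \<open>simp add: \<beta>_def\<close>)
      show "norm (a i) \<le> b i * (1 / \<omega> n)" if "i \<in> J n" for i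
        using ab[of i] wn that by (auto simp: J_def field_simps)
    qed
    thus ?thesis using wn by (simp add: field_simps)
  qed
  obtain T where T: "((\<lambda>n. norm (c n) * \<omega> n) has_sum T) {1..}" "T \<le> S"
    using has_sum_comparison[OF \<beta>, of "\<lambda>n. norm (c n) * \<omega> n"] cb weight_ge_1[OF w]
    by (smt (verit, best) atLeast_iff mult_nonneg_nonneg norm_ge_zero)
  have "((\<lambda>n. scaleC (dmono s n) (c n)) has_sum f s) {1..}" if "s \<in> right_half_plane" for s
  proof (rule has_sum_SigmaD)
    show "((\<lambda>(n,i). scaleC (dmono s n) (a i)) has_sum f s) (Sigma {1..} J)"
      using f[OF that] has_sum_reindex[OF inj, unfolded img, of "\<lambda>(n,i). scaleC (dmono s n) (a i)" "f s"]
      by (simp add: o_def h_def)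
    show "((\<lambda>i. case (n, i) of (n, i) \<Rightarrow> scaleC (dmono s n) (a i)) has_sum scaleC (dmono s n) (c n)) (J n)"
      for n
      using has_sum_bounded_linear[OF bounded_linear_scaleC_right has_sum_infsum[OF aJ]]
      by (simp add: c_def)
  qed
  thus ?thesis using T SB unfolding dir_bounded_def by (meson order_trans)
qed

lemma dir_boundedE:
  assumes "dir_bounded \<omega> B f"
  obtains c S where "((\<lambda>n. norm (c n) * \<omega> n) has_sum S) {1..}" "S \<le> B"
    "\<And>s. s \<in> right_half_plane \<Longrightarrow> ((\<lambda>n. scaleC (dmono s n) (c n)) has_sum f s) {1..}"
  using assms unfolding dir_bounded_def by blast

lemma dir_bounded_mono: "dir_bounded \<omega> B f \<Longrightarrow> B \<le> C \<Longrightarrow> dir_bounded \<omega> C f"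
  unfolding dir_bounded_def by (meson order_trans)

text \<open>Monomials have modulus at most 1 on the half-plane and weights are at least 1. This
  carries estimates in the Dirichlet algebra over to values in the coefficient algebra.\<close>

lemma dir_bounded_norm_le:
  assumes w: "weight_on_N \<omega>" and f: "dir_bounded \<omega> B f" and s: "s \<in> right_half_plane"
  shows "norm (f s) \<le> B"
proof -
  obtain c S where c: "((\<lambda>n. norm (c n) * \<omega> n) has_sum S) {1..}" "S \<le> B"
    "((\<lambda>n. scaleC (dmono s n) (c n)) has_sum f s) {1..}"
    using dir_boundedE[OF f] s by metis
  have "norm (f s) \<le> S"
    by (rule norm_infsum_le[OF c(3) c(1)]) (use norm_scaleC_dmono_le[OF w s] in auto)
  thus ?thesis using c(2) by linarith
qed

lemma dir_bounded_nonneg: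
  assumes "weight_on_N \<omega>" "dir_bounded \<omega> B f"
  shows "B \<ge> 0"
proof -
  have "(0::complex) \<in> right_half_plane" by (simp add: right_half_plane_def)
  from dir_bounded_norm_le[OF assms this] show ?thesis using norm_ge_zero order_trans by blast
qed

section \<open>Closure under products and under finite and infinite sums\<close>

lemma dir_bounded_finite_sum:
  fixes c :: "nat \<Rightarrow> 'a::comm_complex_banach_algebra_1"
  assumes w: "weight_on_N \<omega>" and F: "finite F" "F \<subseteq> {1..}"
  shows "dir_bounded \<omega> (\<Sum>n\<in>F. norm (c n) * \<omega> n) (\<lambda>s. \<Sum>n\<in>F. scaleC (dmono s n) (c n))"
  by (rule dir_boundedI[OF w, where I = F and m = "\<lambda>n. n" and a = c and
        b = "\<lambda>n. norm (c n) * \<omega> n", OF _ has_sum_finite])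
    (use F in \<open>auto intro: has_sum_finite\<close>)

lemma dir_bounded_const:
  assumes "weight_on_N \<omega>"
  shows "dir_bounded \<omega> (norm a) (\<lambda>_. a::'a::comm_complex_banach_algebra_1)"
  using dir_bounded_finite_sum[OF assms, of "{1}" "\<lambda>_. a"] assms
  by (simp add: scaleC_one weight_on_N_def)

text \<open>The product series is indexed by pairs of frequencies; \<open>dir_boundedI\<close> then
  performs the Dirichlet convolution, and submultiplicativity of the weight supplies the majorant
  \<open>b\<close>.\<close>

lemma dir_bounded_mult:
  fixes f g :: "complex \<Rightarrow> 'a::comm_complex_banach_algebra_1"
  assumes w: "weight_on_N \<omega>" and f: "dir_bounded \<omega> B f" and g: "dir_bounded \<omega> C g"
  shows "dir_bounded \<omega> (B * C) (\<lambda>s. f s * g s)"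
proof -
  obtain c S where c: "((\<lambda>n. norm (c n) * \<omega> n) has_sum S) {1..}" "S \<le> B"
    "\<And>s. s \<in> right_half_plane \<Longrightarrow> ((\<lambda>n. scaleC (dmono s n) (c n)) has_sum f s) {1..}"
    using dir_boundedE[OF f] by metis
  obtain d T where d: "((\<lambda>n. norm (d n) * \<omega> n) has_sum T) {1..}" "T \<le> C"
    "\<And>s. s \<in> right_half_plane \<Longrightarrow> ((\<lambda>n. scaleC (dmono s n) (d n)) has_sum g s) {1..}"
    using dir_boundedE[OF g] by metis
  have wpos: "\<omega> n \<ge> 0" if "n \<ge> 1" for n using weight_ge_1[OF w that] by linarith
  have S0: "S \<ge> 0" by (rule has_sum_nonneg[OF c(1)]) (use wpos in auto)
  have T0: "T \<ge> 0" by (rule has_sum_nonneg[OF d(1)]) (use wpos in auto)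
  let ?I = "{1..} \<times> {1..} :: (nat \<times> nat) set"
  define b where "b = (\<lambda>(m, n). (norm (c m) * \<omega> m) * (norm (d n) * \<omega> n))"
  have b_in: "((\<lambda>n. b (m, n)) has_sum (norm (c m) * \<omega> m) * T) {1..}" for m
    unfolding b_def prod.case by (rule has_sum_cmult_right[OF d(1)])
  have b_out: "((\<lambda>m. (norm (c m) * \<omega> m) * T) has_sum S * T) {1..}"
    by (rule has_sum_cmult_left[OF c(1)])
  have "b summable_on ?I"
    by (rule summable_on_SigmaI[OF b_in]) (use has_sum_imp_summable[OF b_out] wpos in \<open>auto simp: b_def\<close>)
  hence bS: "(b has_sum S * T) ?I"
    by (intro has_sum_SigmaI[OF b_in b_out])
  define a where "a = (\<lambda>(m, n). c m * d n)"
  show ?thesis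
  proof (rule dir_boundedI[OF w, where I = ?I and m = "\<lambda>(m, n). m * n" and a = a, OF _ bS])
    show "(case i of (m, n) \<Rightarrow> m * n) \<ge> 1" if "i \<in> ?I" for i
      using that by (cases i) (simp add: Suc_le_eq)
    show "S * T \<le> B * C" using c(2) d(2) S0 T0 by (intro mult_mono) auto
    show ab: "norm (a i) * \<omega> (case i of (m, n) \<Rightarrow> m * n) \<le> b i" if i: "i \<in> ?I" for i
    proof -
      obtain m n where mn: "i = (m, n)" "m \<ge> 1" "n \<ge> 1" using i by auto
      have "norm (c m * d n) * \<omega> (m * n) \<le> (norm (c m) * norm (d n)) * (\<omega> m * \<omega> n)"
        using weight_mult[OF w mn(2,3)] wpos[of "m * n"] mn
        by (intro mult_mono norm_mult_ineq) auto
      thus ?thesis by (simp add: mn b_def a_def mult_ac)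
    qed
    fix s :: complex assume s: "s \<in> right_half_plane"
    let ?t = "\<lambda>i. scaleC (dmono s (case i of (m, n) \<Rightarrow> m * n)) (a i)"
    have t: "?t (m, n) = scaleC (dmono s m) (c m) * scaleC (dmono s n) (d n)" for m n
      unfolding a_def prod.case dmono_mult by (simp add: scaleC_mult_scaleC)
    show "(?t has_sum f s * g s) ?I"
    proof (rule has_sum_SigmaI)
      show "((\<lambda>n. ?t (m, n)) has_sum scaleC (dmono s m) (c m) * g s) {1..}" for m
        unfolding t by (rule has_sum_cmult_right[OF d(3)[OF s]])
      show "((\<lambda>m. scaleC (dmono s m) (c m) * g s) has_sum f s * g s) {1..}"
        by (rule has_sum_cmult_left[OF c(3)[OF s]])
      have bs: "b summable_on ?I" using bS by (rule has_sum_imp_summable)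
      show "?t summable_on ?I"
      proof (rule abs_summable_summable, rule Infinite_Sum.abs_summable_on_comparison_test'[OF bs])
        fix i assume i: "i \<in> ?I"
        have "(case i of (m, n) \<Rightarrow> m * n) \<ge> 1" using i by (auto simp: Suc_le_eq)
        thus "norm (?t i) \<le> b i"
          using norm_scaleC_dmono_le[OF w s] ab[OF i] order_trans by blast
      qed
    qed
  qed
qed

text \<open>Stands in for completeness of the Dirichlet algebra: a series of elements with summable
  norm bounds stays inside. It is needed for the Neumann series, and merges all coefficient families
  into one doubly indexed family.\<close>

lemma dir_bounded_has_sum:
  fixes f :: "'k \<Rightarrow> complex \<Rightarrow> 'a::comm_complex_banach_algebra_1"
  assumes w: "weight_on_N \<omega>" and f: "\<And>k. k \<in> K \<Longrightarrow> dir_bounded \<omega> (B k) (f k)"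
    and B: "(B has_sum C) K"
    and g: "\<And>s. s \<in> right_half_plane \<Longrightarrow> ((\<lambda>k. f k s) has_sum g s) K"
  shows "dir_bounded \<omega> C g"
proof -
  have "\<forall>k\<in>K. \<exists>c S. ((\<lambda>n. norm (c n) * \<omega> n) has_sum S) {1..} \<and> S \<le> B k \<and>
     (\<forall>s\<in>right_half_plane. ((\<lambda>n. scaleC (dmono s n) (c n)) has_sum f k s) {1..})"
    using f unfolding dir_bounded_def by blast
  from bchoice[OF this] obtain c where "\<forall>k\<in>K. \<exists>S. ((\<lambda>n. norm (c k n) * \<omega> n) has_sum S) {1..} \<and> S \<le> B k \<and>
     (\<forall>s\<in>right_half_plane. ((\<lambda>n. scaleC (dmono s n) (c k n)) has_sum f k s) {1..})"
    by (elim exE)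
  from bchoice[OF this] obtain S where "\<forall>k\<in>K. ((\<lambda>n. norm (c k n) * \<omega> n) has_sum S k) {1..} \<and>
     S k \<le> B k \<and>
     (\<forall>s\<in>right_half_plane. ((\<lambda>n. scaleC (dmono s n) (c k n)) has_sum f k s) {1..})"
    by (elim exE)
  hence c: "\<And>k. k \<in> K \<Longrightarrow> ((\<lambda>n. norm (c k n) * \<omega> n) has_sum S k) {1..}"
    "\<And>k. k \<in> K \<Longrightarrow> S k \<le> B k"
    "\<And>k s. k \<in> K \<Longrightarrow> s \<in> right_half_plane \<Longrightarrow>
        ((\<lambda>n. scaleC (dmono s n) (c k n)) has_sum f k s) {1..}"
    by blast+
  have wpos: "\<omega> n \<ge> 0" if "n \<ge> 1" for n using weight_ge_1[OF w that] by linarith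
  have S0: "S k \<ge> 0" if "k \<in> K" for k
    by (rule has_sum_nonneg[OF c(1)[OF that]]) (use wpos in auto)
  obtain T where T: "(S has_sum T) K" "T \<le> C"
    using has_sum_comparison[OF B, of S] S0 c(2) by blast
  let ?I = "K \<times> {1..} :: ('k \<times> nat) set"
  define b where "b = (\<lambda>(k, n). norm (c k n) * \<omega> n)"
  have b_in: "((\<lambda>n. b (k, n)) has_sum S k) {1..}" if "k \<in> K" for k
    unfolding b_def prod.case by (rule c(1)[OF that])
  have bs: "b summable_on ?I"
    by (rule summable_on_SigmaI[OF b_in]) (use has_sum_imp_summable[OF T(1)] wpos in \<open>auto simp: b_def\<close>)
  hence bS: "(b has_sum T) ?I"
    by (intro has_sum_SigmaI[OF b_in T(1)])
  define a where "a = (\<lambda>(k, n). c k n)"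
  show ?thesis
  proof (rule dir_boundedI[OF w, where I = ?I and m = snd and a = a, OF _ bS T(2)])
    show ab: "norm (a i) * \<omega> (snd i) \<le> b i" if i: "i \<in> ?I" for i
      by (simp add: a_def b_def split_beta)
    fix s :: complex assume s: "s \<in> right_half_plane"
    let ?t = "\<lambda>i. scaleC (dmono s (snd i)) (a i)"
    show "(?t has_sum g s) ?I"
    proof (rule has_sum_SigmaI)
      show "((\<lambda>n. ?t (k, n)) has_sum f k s) {1..}" if "k \<in> K" for k
        using c(3)[OF that s] by (simp add: a_def)
      show "((\<lambda>k. f k s) has_sum g s) K" by (rule g[OF s])
      show "?t summable_on ?I"
      proof (rule abs_summable_summable, rule Infinite_Sum.abs_summable_on_comparison_test'[OF bs])
        fix i assume i: "i \<in> ?I"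
        hence "snd i \<ge> 1" by auto
        thus "norm (?t i) \<le> b i"
          using norm_scaleC_dmono_le[OF w s] ab[OF i] order_trans by blast
      qed
    qed
  qed auto
qed

lemma dir_bounded_sum:
  fixes f :: "'k \<Rightarrow> complex \<Rightarrow> 'a::comm_complex_banach_algebra_1"
  assumes "weight_on_N \<omega>" "finite K" "\<And>k. k \<in> K \<Longrightarrow> dir_bounded \<omega> (B k) (f k)"
  shows "dir_bounded \<omega> (\<Sum>k\<in>K. B k) (\<lambda>s. \<Sum>k\<in>K. f k s)"
  by (rule dir_bounded_has_sum[OF assms(1), of K B f]) (use assms in \<open>auto intro: has_sum_finite\<close>)

lemma dir_bounded_power:
  fixes f :: "complex \<Rightarrow> 'a::comm_complex_banach_algebra_1"
  assumes w: "weight_on_N \<omega>" and f: "dir_bounded \<omega> B f"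
  shows "dir_bounded \<omega> (B ^ n) (\<lambda>s. f s ^ n)"
proof (induction n)
  case 0
  show ?case using dir_bounded_const[OF w, of "1::'a"] by simp
next
  case (Suc n)
  show ?case using dir_bounded_mult[OF w f Suc] by simp
qed


section \<open>Coefficients of Dirichlet polynomials\<close>

text \<open>Discrete Bohr mean: averaging \<open>m\<^sup>s P(s)\<close> over \<open>s = i j h\<close>, \<open>j < N\<close>, isolates the coefficient at
  \<open>m\<close>. The step \<open>h\<close> is so small that no ratio of the frequencies aliases to \<open>1\<close>.\<close>

lemma norm_coeff_le:
  fixes a :: "nat \<Rightarrow> 'a::comm_complex_banach_algebra_1"
  assumes F: "finite F" "F \<subseteq> {1..}" and m: "m \<in> F"
    and M: "\<And>s. s \<in> right_half_plane \<Longrightarrow> norm (\<Sum>n\<in>F. scaleC (dmono s n) (a n)) \<le> M"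
  shows "norm (a m) \<le> M"
proof -
  \<comment> \<open>\<open>L\<close> dominates every difference of logarithms of frequencies, so
    each phase \<open>x n\<close> has modulus below 1 and hence is a multiple of 2 pi only if it is
    0, that is, if \<open>n = m\<close>.\<close>
  define L where "L = (\<Sum>n\<in>F. ln (real n))"
  define h where "h = 1 / (1 + L)"
  have ln0: "ln (real n) \<ge> 0" if "n \<in> F" for n using F(2) that by auto
  have lnL: "ln (real n) \<le> L" if "n \<in> F" for n
    unfolding L_def using F(1) ln0 that by (intro member_le_sum) auto
  have L0: "L \<ge> 0" unfolding L_def using ln0 by (rule sum_nonneg)
  have h: "h > 0" "h * L < 1" using L0 by (auto simp: h_def field_simps)
  define x where "x n = h * (ln (real m) - ln (real n))" for n
  define q where "q n = exp (\<i> * of_real (x n))" for n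
  \<comment> \<open>\<open>w ^ j\<close> is the value of m to the power \<open>s j\<close>;
    multiplying by \<open>dmono (s j) n\<close> leaves \<open>q n ^ j\<close>, a geometric
    progression in \<open>j\<close>.\<close>
  define w where "w = exp (\<i> * of_real (h * ln (real m)))"
  define s where "s j = \<i> * of_real (real j * h)" for j :: nat
  define P where "P s = (\<Sum>n\<in>F. scaleC (dmono s n) (a n))" for s
  have qm: "q m = 1" by (simp add: q_def x_def)
  have qn: "q n \<noteq> 1" if n: "n \<in> F" "n \<noteq> m" for n
  proof
    assume "q n = 1"
    then obtain k :: int where k: "x n = of_int (2 * k) * pi"
      by (auto simp: q_def exp_eq_1)
    have "\<bar>ln (real m) - ln (real n)\<bar> \<le> L"
      using lnL ln0 m n(1) by (smt (verit))
    hence "\<bar>x n\<bar> \<le> h * L" using h by (simp add: x_def abs_mult)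
    hence x1: "\<bar>x n\<bar> < 1" using h by linarith
    have "real m > 0" "real n > 0" using m n(1) F(2) by auto
    hence "x n \<noteq> 0" using h n(2) by (simp add: x_def)
    hence "k \<noteq> 0" using k by auto
    hence "\<bar>real_of_int (2 * k)\<bar> \<ge> 1" by linarith
    hence "\<bar>x n\<bar> \<ge> 1 * pi" unfolding k abs_mult by (intro mult_mono) auto
    with x1 pi_gt3 show False by linarith
  qed
  have wq: "w ^ j * dmono (s j) n = q n ^ j" if "n \<in> F" for j n
  proof -
    have "n \<ge> 1" using that F(2) by auto
    hence "dmono (s j) n = exp (- s j * of_real (ln (real n)))"
      by (simp add: powr_def Ln_of_nat)
    thus ?thesis
      by (simp add: w_def q_def x_def s_def exp_of_nat_mult[symmetric] exp_add[symmetric] algebra_simps)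
  qed
  \<comment> \<open>The geometric sums with ratio \<open>q n \<noteq> 1\<close> are bounded
    uniformly in \<open>N\<close>, as the numerator has modulus at most 2. So \<open>K\<close>
    bounds the contribution of all other frequencies.\<close>
  define K where "K = (\<Sum>n\<in>F - {m}. 2 / cmod (q n - 1) * norm (a n))"
  have key: "real N * norm (a m) \<le> real N * M + K" for N :: nat
  proof -
    have "(\<Sum>j<N. scaleC (w ^ j) (P (s j))) = (\<Sum>j<N. \<Sum>n\<in>F. scaleC (q n ^ j) (a n))"
      unfolding P_def scaleC_sum_right scaleC_scaleC by (intro sum.cong refl) (simp add: wq)
    also have "\<dots> = (\<Sum>n\<in>F. scaleC (\<Sum>j<N. q n ^ j) (a n))"
      unfolding scaleC_sum_left by (rule sum.swap)
    also have "\<dots> = scaleC (of_nat N) (a m) + (\<Sum>n\<in>F-{m}. scaleC (\<Sum>j<N. q n ^ j) (a n))"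
      using sum.remove[OF F(1) m, of "\<lambda>n. scaleC (\<Sum>j<N. q n ^ j) (a n)"] by (simp add: qm)
    finally have eq: "scaleC (of_nat N) (a m)
        = (\<Sum>j<N. scaleC (w ^ j) (P (s j))) - (\<Sum>n\<in>F-{m}. scaleC (\<Sum>j<N. q n ^ j) (a n))"
      by simp
    have 1: "norm (\<Sum>j<N. scaleC (w ^ j) (P (s j))) \<le> real (card {..<N}) * M"
    proof (rule sum_norm_bound)
      fix j
      have "s j \<in> right_half_plane" by (simp add: s_def right_half_plane_def)
      thus "norm (scaleC (w ^ j) (P (s j))) \<le> M"
        using M[of "s j"] by (simp add: norm_scaleC norm_power w_def P_def)
    qed
    have 2: "norm (\<Sum>n\<in>F-{m}. scaleC (\<Sum>j<N. q n ^ j) (a n)) \<le> K"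
      unfolding K_def
    proof (rule sum_norm_le)
      fix n assume n: "n \<in> F - {m}"
      have "cmod (q n ^ N - 1) \<le> 2"
        using norm_triangle_ineq4[of "q n ^ N" 1] by (simp add: norm_power q_def)
      hence "cmod (\<Sum>j<N. q n ^ j) \<le> 2 / cmod (q n - 1)"
        using qn[of n] n by (simp add: geometric_sum norm_divide divide_right_mono)
      thus "norm (scaleC (\<Sum>j<N. q n ^ j) (a n)) \<le> 2 / cmod (q n - 1) * norm (a n)"
        unfolding norm_scaleC by (rule mult_right_mono) simp
    qed
    have "real N * norm (a m) = norm (scaleC (of_nat N) (a m))" by (simp add: norm_scaleC)
    also have "\<dots> \<le> real N * M + K"
      unfolding eq using 1 2 norm_triangle_ineq4 by (smt (verit) card_lessThan)
    finally show ?thesis .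
  qed
  \<comment> \<open>Dividing \<open>key\<close> by \<open>N\<close> and letting \<open>N\<close>
    grow removes \<open>K\<close>.\<close>
  show ?thesis
  proof (rule ccontr)
    assume "\<not> norm (a m) \<le> M"
    then obtain N :: nat where "K < real N * (norm (a m) - M)"
      using reals_Archimedean3[of "norm (a m) - M"] by auto
    with key[of N] show False by (simp add: algebra_simps)
  qed
qed

section \<open>Subexponential growth\<close>

text \<open>For nonnegative \<open>u\<close> this says that the limsup of the j-th roots of
  \<open>u j\<close> is at most 1, in a form stable under products.\<close>

definition subexp :: "(nat \<Rightarrow> real) \<Rightarrow> bool" where
  "subexp u \<longleftrightarrow> (\<forall>r>1. \<exists>C. \<forall>j. u j \<le> C * r ^ j)"

lemma subexp_mult:
  assumes u: "subexp u" "\<And>j. u j \<ge> 0" and v: "subexp v" "\<And>j. v j \<ge> 0"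
  shows "subexp (\<lambda>j. u j * v j)"
  unfolding subexp_def
proof (intro allI impI)
  fix r :: real assume r: "r > 1"
  \<comment> \<open>Each factor is allowed half of the exponential rate.\<close>
  hence "sqrt r > 1" by simp
  then obtain C D where C: "\<And>j. u j \<le> C * sqrt r ^ j" and D: "\<And>j. v j \<le> D * sqrt r ^ j"
    using u(1) v(1) unfolding subexp_def by meson
  have "u j * v j \<le> (C * D) * r ^ j" for j
  proof -
    have "u j * v j \<le> (C * sqrt r ^ j) * (D * sqrt r ^ j)"
      using C[of j] D[of j] u(2)[of j] v(2)[of j] by (intro mult_mono) auto
    also have "\<dots> = (C * D) * (sqrt r * sqrt r) ^ j" by (simp only: power_mult_distrib mult_ac)
    also have "sqrt r * sqrt r = r" using r by simp
    finally show ?thesis .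
  qed
  thus "\<exists>C. \<forall>j. u j * v j \<le> C * r ^ j" by blast
qed

lemma subexp_prod:
  assumes "finite F" "\<And>m. m \<in> F \<Longrightarrow> subexp (u m)" "\<And>m j. m \<in> F \<Longrightarrow> u m j \<ge> 0"
  shows "subexp (\<lambda>j. \<Prod>m\<in>F. u m j)"
  using assms
proof (induction F rule: finite_induct)
  case empty
  have "\<exists>C. \<forall>j. 1 \<le> C * r ^ j" if "r > 1" for r :: real
    by (rule exI[of _ 1]) (use that one_le_power[of r] in auto)
  thus ?case by (simp add: subexp_def)
next
  case (insert x F)
  have "subexp (\<lambda>j. u x j * (\<Prod>m\<in>F. u m j))"
    using insert by (intro subexp_mult) (auto intro: prod_nonneg)
  with insert show ?case by simp
qed

text \<open>Admissibility bounds \<open>\<omega> (m ^ k)\<close> by \<open>r ^ k\<close> for all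
  large \<open>k\<close>; the finitely many other values go into the constant, and summing up to
  \<open>j\<close> costs only the geometric factor \<open>r / (r - 1)\<close>.\<close>

lemma subexp_weight_powers:
  assumes \<omega>: "admissible_weight \<omega>" and m: "m \<ge> 1"
  shows "subexp (\<lambda>j. \<Sum>b\<le>j. \<omega> (m ^ b))"
  unfolding subexp_def
proof (intro allI impI)
  fix r :: real assume r: "r > 1"
  have w: "weight_on_N \<omega>" and lim: "(\<lambda>k. \<omega> (m ^ k) powr (1 / real k)) \<longlonglongrightarrow> 1"
    using \<omega> m by (auto simp: admissible_weight_def)
  have w1: "\<omega> (m ^ k) \<ge> 1" for k using weight_ge_1[OF w] m by simp
  from order_tendstoD(2)[OF lim r] obtain K where K: "\<And>k. k \<ge> K \<Longrightarrow> \<omega> (m ^ k) powr (1 / real k) < r"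
    by (auto simp: eventually_sequentially)
  \<comment> \<open>A sum rather than a maximum: it dominates each early term, and its term at
    \<open>k = 0\<close> makes it at least 1, which also covers the late terms.\<close>
  define C where "C = (\<Sum>k\<le>K. \<omega> (m ^ k))"
  have "(\<Sum>k\<le>0. \<omega> (m ^ k)) \<le> C"
    unfolding C_def by (rule sum_mono2) (use w1 order_trans[OF zero_le_one] in auto)
  with w1[of 0] have C1: "C \<ge> 1" by simp
  have b: "\<omega> (m ^ k) \<le> C * r ^ k" for k
  proof (cases "k \<le> K")
    case True
    have "\<omega> (m ^ k) \<le> C"
      unfolding C_def by (rule member_le_sum) (use True w1 order_trans[OF zero_le_one] in auto)
    also have "C * 1 \<le> C * r ^ k" using C1 r by (intro mult_left_mono) auto
    finally show ?thesis by simp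
  next
    case False
    hence k: "k > 0" "k \<ge> K" by auto
    have "\<omega> (m ^ k) = (\<omega> (m ^ k) powr (1 / real k)) powr real k"
      using k w1[of k] by (simp add: powr_powr)
    also have "\<dots> \<le> r powr real k" using K[OF k(2)] by (intro powr_mono2) auto
    also have "\<dots> = 1 * r ^ k" using r by (simp add: powr_realpow)
    also have "\<dots> \<le> C * r ^ k" using C1 r by (intro mult_right_mono) auto
    finally show ?thesis .
  qed
  have "(\<Sum>b\<le>j. \<omega> (m ^ b)) \<le> (C * (r / (r - 1))) * r ^ j" for j
  proof -
    have "(\<Sum>b\<le>j. \<omega> (m ^ b)) \<le> (\<Sum>b\<le>j. C * r ^ b)" by (intro sum_mono b)
    also have "\<dots> = C * ((r ^ Suc j - 1) / (r - 1))"
      using r geometric_sum[of r "Suc j"] by (simp add: lessThan_Suc_atMost flip: sum_distrib_left)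
    also have "\<dots> \<le> C * ((r ^ Suc j) / (r - 1))"
      using C1 r by (intro mult_left_mono divide_right_mono) auto
    finally show ?thesis by (simp add: mult_ac)
  qed
  thus "\<exists>C. \<forall>j. (\<Sum>b\<le>j. \<omega> (m ^ b)) \<le> C * r ^ j" by blast
qed


section \<open>Powers of elements of the Dirichlet algebra\<close>

text \<open>Every product of \<open>j\<close> elements of \<open>F\<close> lies in this set. The
  exponents are bounded separately by \<open>j\<close> instead of adding up to \<open>j\<close>:
  over a box of exponents the sum of the weights factors.\<close>

definition pow_freqs :: "nat set \<Rightarrow> nat \<Rightarrow> nat set" where
  "pow_freqs F j = (\<lambda>\<beta>. \<Prod>m\<in>F. m ^ \<beta> m) ` (\<Pi>\<^sub>E m\<in>F. {..j})"

lemma finite_pow_freqs: "finite F \<Longrightarrow> finite (pow_freqs F j)"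
  by (simp add: pow_freqs_def finite_PiE)

lemma pow_freqs_subset: "F \<subseteq> {1..} \<Longrightarrow> pow_freqs F j \<subseteq> {1..}"
  by (force simp: pow_freqs_def Suc_le_eq intro!: prod_pos)

lemma one_in_pow_freqs: "1 \<in> pow_freqs F j"
  unfolding pow_freqs_def by (rule image_eqI[of _ _ "\<lambda>x\<in>F. 0"]) auto

lemma mult_in_pow_freqs:
  assumes F: "finite F" and m: "m \<in> F" and n: "n \<in> pow_freqs F j"
  shows "m * n \<in> pow_freqs F (Suc j)"
proof -
  obtain \<beta> where \<beta>: "\<beta> \<in> (\<Pi>\<^sub>E m\<in>F. {..j})" "n = (\<Prod>m\<in>F. m ^ \<beta> m)"
    using n by (auto simp: pow_freqs_def)
  let ?\<gamma> = "\<beta>(m := Suc (\<beta> m))"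
  have "?\<gamma> \<in> (\<Pi>\<^sub>E m\<in>F. {..Suc j})"
    using \<beta>(1) m by (force simp: PiE_iff extensional_def le_Suc_eq)
  moreover have "m * n = (\<Prod>m\<in>F. m ^ ?\<gamma> m)"
    using prod.remove[OF F m, of "\<lambda>m. m ^ \<beta> m"] prod.remove[OF F m, of "\<lambda>m. m ^ ?\<gamma> m"]
    by (simp add: \<beta>(2) mult_ac)
  ultimately show ?thesis unfolding pow_freqs_def by blast
qed

text \<open>No formula for \<open>d\<close> is kept: later its values are bounded only through the
  supremum of the power, by \<open>norm_coeff_le\<close>.\<close>

lemma dirichlet_poly_power:
  fixes c :: "nat \<Rightarrow> 'a::comm_complex_banach_algebra_1"
  assumes F: "finite F"
  shows "\<exists>d. \<forall>s. (\<Sum>n\<in>F. scaleC (dmono s n) (c n)) ^ j = (\<Sum>n\<in>pow_freqs F j. scaleC (dmono s n) (d n))"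
proof (induction j)
  case 0
  have "(\<Sum>n\<in>pow_freqs F 0. scaleC (dmono s n) (if n = 1 then 1 else (0::'a))) = 1" for s
  proof -
    have "(\<Sum>n\<in>pow_freqs F 0. scaleC (dmono s n) (if n = 1 then 1 else (0::'a)))
        = (\<Sum>n\<in>pow_freqs F 0. if n = 1 then 1 else (0::'a))"
      by (rule sum.cong) (auto simp: scaleC_one)
    thus ?thesis using one_in_pow_freqs[of F 0] finite_pow_freqs[OF F] by simp
  qed
  thus ?case by (intro exI[of _ "\<lambda>n. if n = 1 then 1 else 0"]) simp
next
  case (Suc j)
  then obtain d where d: "\<And>s. (\<Sum>n\<in>F. scaleC (dmono s n) (c n)) ^ j
      = (\<Sum>n\<in>pow_freqs F j. scaleC (dmono s n) (d n))" by blast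
  let ?S = "F \<times> pow_freqs F j" and ?g = "\<lambda>(m, n). m * n"
  \<comment> \<open>Dirichlet convolution: terms are grouped by the product of their
    frequencies.\<close>
  define e where "e k = (\<Sum>(m, n)\<in>{p \<in> ?S. ?g p = k}. c m * d n)" for k
  have "(\<Sum>n\<in>F. scaleC (dmono s n) (c n)) ^ Suc j
      = (\<Sum>k\<in>pow_freqs F (Suc j). scaleC (dmono s k) (e k))" for s
  proof -
    have "(\<Sum>n\<in>F. scaleC (dmono s n) (c n)) ^ Suc j
        = (\<Sum>p\<in>?S. scaleC (dmono s (?g p)) (case p of (m, n) \<Rightarrow> c m * d n))"
      unfolding power_Suc d sum_product sum.cartesian_product
      by (intro sum.cong refl) (clarsimp simp: scaleC_mult_scaleC simp flip: dmono_mult of_nat_mult)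
    also have "\<dots> = (\<Sum>k\<in>pow_freqs F (Suc j).
        sum (\<lambda>p. scaleC (dmono s (?g p)) (case p of (m, n) \<Rightarrow> c m * d n)) {p \<in> ?S. ?g p = k})"
      by (rule sum.group[symmetric]) (auto simp: F finite_pow_freqs mult_in_pow_freqs)
    also have "\<dots> = (\<Sum>k\<in>pow_freqs F (Suc j). scaleC (dmono s k) (e k))"
      unfolding e_def scaleC_sum_right by (intro sum.cong refl) auto
    finally show ?thesis .
  qed
  thus ?case by blast
qed

lemma weight_prod:
  assumes w: "weight_on_N \<omega>" and F: "finite F" "\<And>m. m \<in> F \<Longrightarrow> x m \<ge> 1"
  shows "\<omega> (\<Prod>m\<in>F. x m) \<le> (\<Prod>m\<in>F. \<omega> (x m))"
  using F
proof (induction F rule: finite_induct)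
  case empty
  thus ?case using w by (simp add: weight_on_N_def)
next
  case (insert y F)
  have p: "(\<Prod>m\<in>F. x m) \<ge> 1" using insert.prems by (force simp: Suc_le_eq intro!: prod_pos)
  have y: "x y \<ge> 1" using insert.prems by simp
  have "\<omega> (x y * (\<Prod>m\<in>F. x m)) \<le> \<omega> (x y) * \<omega> (\<Prod>m\<in>F. x m)"
    by (rule weight_mult[OF w y p])
  also have "\<dots> \<le> \<omega> (x y) * (\<Prod>m\<in>F. \<omega> (x m))"
    using insert weight_ge_1[OF w y] by (intro mult_left_mono) auto
  finally show ?case using insert by simp
qed

text \<open>Different exponent vectors may give the same integer, so passing to a sum over vectors
  only increases the value. Submultiplicativity then bounds each weight by a product, and the sum
  over the box factors.\<close>

lemma sum_weight_pow_freqs: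
  assumes w: "weight_on_N \<omega>" and F: "finite F" "F \<subseteq> {1..}"
  shows "(\<Sum>n\<in>pow_freqs F j. \<omega> n) \<le> (\<Prod>m\<in>F. \<Sum>b\<le>j. \<omega> (m ^ b))"
proof -
  let ?I = "\<Pi>\<^sub>E m\<in>F. {..j}" and ?p = "\<lambda>\<beta>. \<Prod>m\<in>F. m ^ \<beta> m"
  have w0: "\<omega> n \<ge> 0" if "n \<in> pow_freqs F j" for n
    using weight_ge_1[OF w, of n] pow_freqs_subset[OF F(2)] that by force
  have "sum \<omega> (?p ` ?I) \<le> sum (\<omega> \<circ> ?p) ?I"
    by (rule sum_image_le) (use F w0 in \<open>auto simp: pow_freqs_def finite_PiE\<close>)
  also have "\<dots> \<le> (\<Sum>\<beta>\<in>?I. \<Prod>m\<in>F. \<omega> (m ^ \<beta> m))"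
    unfolding o_def by (intro sum_mono weight_prod[OF w F(1)]) (use F(2) in auto)
  also have "\<dots> = (\<Prod>m\<in>F. \<Sum>b\<le>j. \<omega> (m ^ b))"
    by (rule prod_sum_PiE[symmetric]) (use F in auto)
  finally show ?thesis by (simp add: pow_freqs_def)
qed

text \<open>Each coefficient of the j-th power has norm at most \<open>M ^ j\<close>, and the total
  weight of its frequencies is at most a constant times \<open>(R / M) ^ j\<close>. The number of
  frequencies in \<open>F\<close> affects only the constant.\<close>

lemma dir_bounded_poly_power:
  fixes c :: "nat \<Rightarrow> 'a::comm_complex_banach_algebra_1"
  assumes \<omega>: "admissible_weight \<omega>" and F: "finite F" "F \<subseteq> {1..}"
    and P: "\<And>s. s \<in> right_half_plane \<Longrightarrow> norm (\<Sum>n\<in>F. scaleC (dmono s n) (c n)) \<le> M"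
    and M: "0 < M" "M < R"
  shows "\<exists>C. \<forall>j. dir_bounded \<omega> (C * R ^ j) (\<lambda>s. (\<Sum>n\<in>F. scaleC (dmono s n) (c n)) ^ j)"
proof -
  have w: "weight_on_N \<omega>" using \<omega> by (simp add: admissible_weight_def)
  define W where "W j = (\<Prod>m\<in>F. \<Sum>b\<le>j. \<omega> (m ^ b))" for j
  have "subexp W"
    unfolding W_def
  proof (rule subexp_prod[OF F(1)])
    fix m assume "m \<in> F"
    hence m: "m \<ge> 1" using F(2) by auto
    show "subexp (\<lambda>j. \<Sum>b\<le>j. \<omega> (m ^ b))" by (rule subexp_weight_powers[OF \<omega> m])
    have "\<omega> (m ^ b) \<ge> 0" for b using weight_ge_1[OF w, of "m ^ b"] m by simp
    thus "(\<Sum>b\<le>j. \<omega> (m ^ b)) \<ge> 0" for j by (intro sum_nonneg)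
  qed
  then obtain C where C: "\<And>j. W j \<le> C * (R / M) ^ j"
    unfolding subexp_def using M by (metis less_divide_eq_1_pos)
  have "dir_bounded \<omega> (C * R ^ j) (\<lambda>s. (\<Sum>n\<in>F. scaleC (dmono s n) (c n)) ^ j)" for j
  proof -
    obtain d where d: "\<And>s. (\<Sum>n\<in>F. scaleC (dmono s n) (c n)) ^ j
        = (\<Sum>n\<in>pow_freqs F j. scaleC (dmono s n) (d n))"
      using dirichlet_poly_power[OF F(1), of c j] by blast
    note fin = finite_pow_freqs[OF F(1), of j] and sub = pow_freqs_subset[OF F(2), of j]
    have dn: "norm (d n) \<le> M ^ j" if "n \<in> pow_freqs F j" for n
    proof (rule norm_coeff_le[OF fin sub that])
      fix s assume "s \<in> right_half_plane"
      thus "norm (\<Sum>n\<in>pow_freqs F j. scaleC (dmono s n) (d n)) \<le> M ^ j"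
        unfolding d[symmetric]
        by (intro order_trans[OF norm_power_ineq] power_mono P norm_ge_zero)
    qed
    have "(\<Sum>n\<in>pow_freqs F j. norm (d n) * \<omega> n) \<le> (\<Sum>n\<in>pow_freqs F j. M ^ j * \<omega> n)"
      using dn sub weight_ge_1[OF w] order_trans[OF zero_le_one]
      by (intro sum_mono mult_right_mono) (auto simp: subset_iff)
    also have "\<dots> = M ^ j * (\<Sum>n\<in>pow_freqs F j. \<omega> n)" by (simp add: sum_distrib_left)
    also have "\<dots> \<le> M ^ j * (C * (R / M) ^ j)"
      using order_trans[OF sum_weight_pow_freqs[OF w F] C[of j, unfolded W_def]] M
      by (intro mult_left_mono) auto
    also have "\<dots> = C * R ^ j" using M by (simp add: power_divide)
    finally show ?thesis
      unfolding d by (rule dir_bounded_mono[OF dir_bounded_finite_sum[OF w fin sub]])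
  qed
  thus ?thesis by blast
qed

section \<open>Polynomial approximation and the spectral radius\<close>

lemma dir_bounded_approx:
  fixes g :: "complex \<Rightarrow> 'a::comm_complex_banach_algebra_1"
  assumes w: "weight_on_N \<omega>" and g: "dir_bounded \<omega> B g" and \<epsilon>: "\<epsilon> > 0"
  obtains F c where "finite F" "F \<subseteq> {1..}"
    "dir_bounded \<omega> \<epsilon> (\<lambda>s. g s - (\<Sum>n\<in>F. scaleC (dmono s n) (c n)))"
proof -
  obtain c S where c: "((\<lambda>n. norm (c n) * \<omega> n) has_sum S) {1..}"
    "\<And>s. s \<in> right_half_plane \<Longrightarrow> ((\<lambda>n. scaleC (dmono s n) (c n)) has_sum g s) {1..}"
    using dir_boundedE[OF g] by metis
  obtain F where F: "finite F" "F \<subseteq> {1..}" "dist (\<Sum>n\<in>F. norm (c n) * \<omega> n) S \<le> \<epsilon>"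
    using has_sum_finite_approximation[OF c(1) \<epsilon>] by blast
  have "dir_bounded \<omega> \<epsilon> (\<lambda>s. g s - (\<Sum>n\<in>F. scaleC (dmono s n) (c n)))"
  proof (rule dir_boundedI[OF w, where I = "{1..} - F" and m = "\<lambda>n. n" and a = c and
        b = "\<lambda>n. norm (c n) * \<omega> n"])
    show "((\<lambda>n. norm (c n) * \<omega> n) has_sum (S - (\<Sum>n\<in>F. norm (c n) * \<omega> n))) ({1..} - F)"
      by (rule has_sum_Diff[OF c(1) has_sum_finite[OF F(1)] F(2)])
    show "S - (\<Sum>n\<in>F. norm (c n) * \<omega> n) \<le> \<epsilon>" using F(3) by (simp add: dist_real_def)
    show "((\<lambda>n. scaleC (dmono s n) (c n)) has_sum g s - (\<Sum>n\<in>F. scaleC (dmono s n) (c n))) ({1..} - F)"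
      if "s \<in> right_half_plane" for s
      by (rule has_sum_Diff[OF c(2)[OF that] has_sum_finite[OF F(1)] F(2)])
  qed auto
  with F that show thesis by blast
qed

text \<open>The spectral radius in the Dirichlet algebra is at most the supremum norm.\<close>

lemma dir_bounded_powers:
  fixes g :: "complex \<Rightarrow> 'a::comm_complex_banach_algebra_1"
  assumes \<omega>: "admissible_weight \<omega>" and g: "dir_bounded \<omega> B g"
    and M: "\<And>s. s \<in> right_half_plane \<Longrightarrow> norm (g s) \<le> M" and R: "M < R"
  shows "\<exists>C. \<forall>n. dir_bounded \<omega> (C * R ^ n) (\<lambda>s. g s ^ n)"
proof -
  have w: "weight_on_N \<omega>" using \<omega> by (simp add: admissible_weight_def)
  have "norm (g 0) \<le> M" by (rule M) (simp add: right_half_plane_def)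
  hence M0: "M \<ge> 0" using norm_ge_zero order_trans by blast
  \<comment> \<open>Three of the four quarters are spent: one in the supremum of \<open>P\<close>,
    one for a rate strictly above that supremum, one for the remainder \<open>g - P\<close>.\<close>
  define \<epsilon> where "\<epsilon> = (R - M) / 4"
  have \<epsilon>: "\<epsilon> > 0" using R by (simp add: \<epsilon>_def)
  obtain F c where F: "finite F" "F \<subseteq> {1..}"
    and h: "dir_bounded \<omega> \<epsilon> (\<lambda>s. g s - (\<Sum>n\<in>F. scaleC (dmono s n) (c n)))"
    by (rule dir_bounded_approx[OF w g \<epsilon>])
  define P where "P s = (\<Sum>n\<in>F. scaleC (dmono s n) (c n))" for s
  have "norm (P s) \<le> M + \<epsilon>" if "s \<in> right_half_plane" for s
    using M[OF that] dir_bounded_norm_le[OF w h that] norm_triangle_ineq2[of "P s" "g s"]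
    by (simp add: P_def norm_minus_commute)
  then obtain C where C: "\<And>j. dir_bounded \<omega> (C * (M + 2 * \<epsilon>) ^ j) (\<lambda>s. P s ^ j)"
    using dir_bounded_poly_power[OF \<omega> F, of c "M + \<epsilon>" "M + 2 * \<epsilon>"] M0 \<epsilon> unfolding P_def by auto
  have C0: "C \<ge> 0" using dir_bounded_nonneg[OF w C[of 0]] by simp
  have "dir_bounded \<omega> (C * R ^ n) (\<lambda>s. g s ^ n)" for n
  proof -
    \<comment> \<open>Binomial expansion of \<open>g = (g - P) + P\<close>: powers of the small
      remainder use plain submultiplicativity, powers of \<open>P\<close> the bound by its
      supremum.\<close>
    have "dir_bounded \<omega> (\<Sum>k\<le>n. (norm (of_nat (n choose k) :: 'a) * \<epsilon> ^ k) * (C * (M + 2 * \<epsilon>) ^ (n - k)))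
      (\<lambda>s. \<Sum>k\<le>n. (of_nat (n choose k) * (g s - P s) ^ k) * P s ^ (n - k))"
      by (intro dir_bounded_sum[OF w] dir_bounded_mult[OF w] dir_bounded_power[OF w]
          dir_bounded_const[OF w] C finite_atMost h[folded P_def])
    moreover have "(\<Sum>k\<le>n. (of_nat (n choose k) * (g s - P s) ^ k) * P s ^ (n - k)) = g s ^ n" for s
      using binomial_ring[of "g s - P s" "P s" n] by simp
    moreover have "(\<Sum>k\<le>n. (norm (of_nat (n choose k) :: 'a) * \<epsilon> ^ k) * (C * (M + 2 * \<epsilon>) ^ (n - k)))
        = C * (\<epsilon> + (M + 2 * \<epsilon>)) ^ n"
      unfolding binomial_ring[of \<epsilon>] sum_distrib_left by (simp add: mult_ac)
    moreover have "C * (\<epsilon> + (M + 2 * \<epsilon>)) ^ n \<le> C * R ^ n"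
      using C0 M0 \<epsilon> by (intro mult_left_mono power_mono) (auto simp: \<epsilon>_def field_simps)
    ultimately show ?thesis using dir_bounded_mono by simp
  qed
  thus ?thesis by blast
qed


section \<open>Inverses\<close>

definition dir_invertible ::
  "(nat \<Rightarrow> real) \<Rightarrow> (complex \<Rightarrow> 'a::comm_complex_banach_algebra_1) \<Rightarrow> bool" where
  "dir_invertible \<omega> f \<longleftrightarrow>
     (\<exists>B g. dir_bounded \<omega> B g \<and> (\<forall>s\<in>right_half_plane. f s * g s = 1))"

text \<open>The size \<open>\<eta>\<close> of the admissible perturbation depends only on the supremum norm \<open>M\<close> of the inverse,
  not on its norm in the Dirichlet algebra: this is what makes finitely many steps suffice.\<close>

lemma dir_invertible_perturb:
  fixes F F' G :: "complex \<Rightarrow> 'a::comm_complex_banach_algebra_1"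
  assumes \<omega>: "admissible_weight \<omega>" and G: "dir_bounded \<omega> B G"
    and FG: "\<And>s. s \<in> right_half_plane \<Longrightarrow> F s * G s = 1"
    and M: "\<And>s. s \<in> right_half_plane \<Longrightarrow> norm (G s) \<le> M"
    and u: "dir_bounded \<omega> \<eta> (\<lambda>s. F s - F' s)" and \<eta>: "\<eta> * (M + 1) < 1"
  shows "dir_invertible \<omega> F'"
proof -
  have w: "weight_on_N \<omega>" using \<omega> by (simp add: admissible_weight_def)
  have "norm (G 0) \<le> M" by (rule M) (simp add: right_half_plane_def)
  hence M0: "M \<ge> 0" using norm_ge_zero order_trans by blast
  have \<eta>0: "\<eta> \<ge> 0" by (rule dir_bounded_nonneg[OF w u])
  \<comment> \<open>Any rate strictly above the supremum \<open>M\<close> would do;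
    \<open>M + 1\<close> matches the hypothesis on \<open>\<eta>\<close>.\<close>
  have "\<exists>C. \<forall>n. dir_bounded \<omega> (C * (M + 1) ^ n) (\<lambda>s. G s ^ n)"
    by (rule dir_bounded_powers[OF \<omega> G M]) auto
  then obtain C where C: "\<And>n. dir_bounded \<omega> (C * (M + 1) ^ n) (\<lambda>s. G s ^ n)" by blast
  define \<rho> where "\<rho> = \<eta> * (M + 1)"
  have \<rho>: "0 \<le> \<rho>" "\<rho> < 1" using M0 \<eta>0 \<eta> by (auto simp: \<rho>_def)
  define T where "T n s = (F s - F' s) ^ n * G s ^ Suc n" for n s
  define A where "A n = (C * (M + 1)) * \<rho> ^ n" for n
  have "dir_bounded \<omega> (\<eta> ^ n * (C * (M + 1) ^ Suc n)) (T n)" for n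
    unfolding T_def by (intro dir_bounded_mult[OF w] dir_bounded_power[OF w u] C)
  moreover have "\<eta> ^ n * (C * (M + 1) ^ Suc n) = A n" for n
    by (simp add: A_def \<rho>_def power_mult_distrib)
  ultimately have T: "dir_bounded \<omega> (A n) (T n)" for n by simp
  have "summable A"
    unfolding A_def[abs_def] using \<rho> by (intro summable_mult summable_geometric) simp
  from sums_nonneg_imp_has_sum[OF summable_sums[OF this] dir_bounded_nonneg[OF w T]]
  have Asum: "(A has_sum suminf A) UNIV" .
  have Tsum: "((\<lambda>n. T n s) has_sum (\<Sum>\<^sub>\<infinity>n. T n s)) UNIV" if s: "s \<in> right_half_plane" for s
  proof -
    have "(\<lambda>n. norm (T n s)) summable_on UNIV"
      by (rule Infinite_Sum.abs_summable_on_comparison_test'[OF has_sum_imp_summable[OF Asum]])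
        (rule dir_bounded_norm_le[OF w T s])
    thus ?thesis by (rule has_sum_infsum[OF abs_summable_summable])
  qed
  have K: "dir_bounded \<omega> (suminf A) (\<lambda>s. \<Sum>\<^sub>\<infinity>n. T n s)"
    by (rule dir_bounded_has_sum[OF w T Asum Tsum])
  have "F' s * (\<Sum>\<^sub>\<infinity>n. T n s) = 1" if s: "s \<in> right_half_plane" for s
  proof -
    define u where "u = F s - F' s"
    \<comment> \<open>Since \<open>F' s = F s - u\<close> and \<open>F s * G s = 1\<close>, the
      product of \<open>F' s\<close> with the series telescopes to \<open>t 0 = 1\<close>.\<close>
    define t where "t n = u ^ n * G s ^ n" for n
    have Ts: "(\<lambda>n. T n s) sums (\<Sum>\<^sub>\<infinity>n. T n s)" by (rule has_sum_imp_sums[OF Tsum[OF s]])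
    have F'T: "F' s * T n s = t n - t (Suc n)" for n
    proof -
      have "F' s * T n s = (F s * G s) * (u ^ n * G s ^ n) - u * T n s"
        by (simp add: T_def u_def algebra_simps)
      thus ?thesis by (simp add: FG[OF s] t_def T_def u_def mult_ac)
    qed
    \<comment> \<open>\<open>u * T n s\<close> is \<open>t (Suc n)\<close>, so the terms of the
      convergent series force \<open>t\<close> to 0.\<close>
    have "(\<lambda>n. u * T n s) \<longlonglongrightarrow> u * 0"
      by (intro tendsto_mult_left summable_LIMSEQ_zero sums_summable[OF Ts])
    hence "t \<longlonglongrightarrow> 0"
      by (simp add: t_def T_def u_def mult_ac filterlim_sequentially_Suc[of t, symmetric])
    from telescope_sums'[OF this] have "(\<lambda>n. F' s * T n s) sums 1"
      unfolding F'T by (simp add: t_def)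
    moreover have "(\<lambda>n. F' s * T n s) sums (F' s * (\<Sum>\<^sub>\<infinity>n. T n s))"
      by (rule sums_mult[OF Ts])
    ultimately show ?thesis by (rule sums_unique2[symmetric])
  qed
  with K show ?thesis unfolding dir_invertible_def by blast
qed

section \<open>Compactness of the closed range and uniform bounds for pointwise inverses\<close>

text \<open>The identity \<open>y = b - b * ((x - a) * y)\<close> has a last term of norm at most
  half of \<open>norm y\<close>, which is absorbed on the left.\<close>

lemma invertible_near:
  fixes a b x y :: "'a::{real_normed_algebra_1, comm_ring_1}"
  assumes ab: "a * b = 1" and xy: "x * y = 1" and near: "norm (x - a) * norm b \<le> 1 / 2"
  shows "norm y \<le> 2 * norm b"
proof -
  have "b * ((x - a) * y) = b * (x * y) - (a * b) * y" by (simp add: algebra_simps)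
  hence y: "y = b - b * ((x - a) * y)" by (simp add: ab xy)
  have "norm (b * ((x - a) * y)) \<le> norm b * (norm (x - a) * norm y)"
    by (intro order_trans[OF norm_mult_ineq] mult_left_mono norm_mult_ineq norm_ge_zero)
  also have "\<dots> = (norm (x - a) * norm b) * norm y" by (simp add: mult_ac)
  also have "\<dots> \<le> 1 / 2 * norm y" using near by (intro mult_right_mono) auto
  finally have "norm (b * ((x - a) * y)) \<le> norm y / 2" by simp
  moreover have "norm y \<le> norm b + norm (b * ((x - a) * y))"
    using norm_triangle_ineq4[of b "b * ((x - a) * y)"] y by simp
  ultimately show ?thesis by simp
qed

text \<open>By \<open>invertible_near\<close> inverses are bounded on a small ball around each point
  of \<open>K\<close>; finitely many such balls cover \<open>K\<close>.\<close>

lemma compact_inverses_bounded: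
  fixes K :: "'a::comm_complex_banach_algebra_1 set"
  assumes K: "compact K" and inv: "K \<subseteq> invertibles"
  shows "\<exists>M. \<forall>x\<in>K. \<forall>y. x * y = 1 \<longrightarrow> norm y \<le> M"
proof -
  have "\<forall>a\<in>K. \<exists>b. a * b = 1" using inv by (auto simp: invertibles_def)
  then obtain b where b: "\<And>a. a \<in> K \<Longrightarrow> a * b a = 1" by metis
  \<comment> \<open>Chosen so that \<open>r a * (norm (b a) + 1) = 1 / 2\<close>, the threshold of
    \<open>invertible_near\<close>.\<close>
  define r where "r a = 1 / (2 * (norm (b a) + 1))" for a
  have r0: "r a > 0" for a by (simp add: r_def add_nonneg_pos)
  have "K \<subseteq> (\<Union>a\<in>K. ball a (r a))" using r0 by force
  then obtain D where D: "D \<subseteq> K" "finite D" "K \<subseteq> (\<Union>a\<in>D. ball a (r a))"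
    using compactE_image[OF K, of K "\<lambda>a. ball a (r a)"] by blast
  have "norm y \<le> (\<Sum>a\<in>D. 2 * norm (b a))" if x: "x \<in> K" and xy: "x * y = 1" for x y
  proof -
    obtain a where a: "a \<in> D" "dist a x < r a" using D(3) x by auto
    have "norm (x - a) * norm (b a) \<le> r a * (norm (b a) + 1)"
      using a(2) r0[of a] by (intro mult_mono) (auto simp: dist_norm norm_minus_commute)
    also have "\<dots> = 1 / 2" by (simp add: r_def field_simps add_nonneg_eq_0_iff)
    finally have "norm y \<le> 2 * norm (b a)"
      using invertible_near[OF b xy] a(1) D(1) by blast
    also have "\<dots> \<le> (\<Sum>a\<in>D. 2 * norm (b a))"
      by (rule member_le_sum) (use a D(2) in auto)
    finally show ?thesis .
  qed
  thus ?thesis by blast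
qed

text \<open>The half-plane is not compact, but the monomials map it into the closed unit disc.
  Treating them as independent variables there puts all values of a Dirichlet polynomial into a
  compact set, even if the algebra is infinite-dimensional.\<close>

lemma compact_scaleC_polydisc:
  fixes c :: "'i \<Rightarrow> 'a::comm_complex_banach_algebra_1"
  assumes "finite F"
  shows "\<exists>K. compact K \<and> (\<forall>z. (\<forall>i\<in>F. cmod (z i) \<le> 1) \<longrightarrow> (\<Sum>i\<in>F. scaleC (z i) (c i)) \<in> K)"
  using assms
proof (induction F rule: finite_induct)
  case empty
  show ?case by (rule exI[of _ "{0}"]) simp
next
  case (insert x F)
  then obtain K where K: "compact K"
    "\<And>z. (\<forall>i\<in>F. cmod (z i) \<le> 1) \<Longrightarrow> (\<Sum>i\<in>F. scaleC (z i) (c i)) \<in> K" by blast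
  let ?D = "(\<lambda>z. scaleC z (c x)) ` cball 0 1"
  have "compact ?D"
    by (intro compact_continuous_image linear_continuous_on bounded_linear_scaleC_left) simp
  hence "compact {p + q |p q. p \<in> ?D \<and> q \<in> K}" by (rule compact_sums[OF _ K(1)])
  moreover have "(\<Sum>i\<in>insert x F. scaleC (z i) (c i)) \<in> {p + q |p q. p \<in> ?D \<and> q \<in> K}"
    if "\<forall>i\<in>insert x F. cmod (z i) \<le> 1" for z
    using that insert.hyps K(2)[of z] by fastforce
  ultimately show ?case by blast
qed

text \<open>Dirichlet polynomials approximate \<open>f\<close> uniformly on the half-plane, and
  their values lie in compact sets; so the range is totally bounded.\<close>

lemma compact_closure_range:
  fixes f :: "complex \<Rightarrow> 'a::comm_complex_banach_algebra_1"
  assumes w: "weight_on_N \<omega>" and f: "dir_bounded \<omega> B f"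
  shows "compact (closure (f ` right_half_plane))"
  unfolding compact_eq_totally_bounded
proof (intro conjI allI impI)
  show "complete (closure (f ` right_half_plane))" by (simp add: complete_eq_closed)
  fix e :: real assume e: "e > 0"
  obtain F c where F: "finite F" "F \<subseteq> {1..}"
    and h: "dir_bounded \<omega> (e / 4) (\<lambda>s. f s - (\<Sum>n\<in>F. scaleC (dmono s n) (c n)))"
    using e by (auto intro: dir_bounded_approx[OF w f, of "e / 4"])
  obtain K where K: "compact K"
    "\<And>z. (\<forall>n\<in>F. cmod (z n) \<le> 1) \<Longrightarrow> (\<Sum>n\<in>F. scaleC (z n) (c n)) \<in> K"
    using compact_scaleC_polydisc[OF F(1), of c] by blast
  obtain k where k: "finite k" "K \<subseteq> (\<Union>x\<in>k. ball x (e / 4))"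
    using K(1) e unfolding compact_eq_totally_bounded by (metis zero_less_divide_iff zero_less_numeral)
  \<comment> \<open>One \<open>e / 4\<close> comes from the net and one from the approximation.
    Closed balls are used because their finite union is closed and so contains the closure
    too.\<close>
  have "f ` right_half_plane \<subseteq> (\<Union>x\<in>k. cball x (e / 2))"
  proof safe
    fix s :: complex assume s: "s \<in> right_half_plane"
    let ?P = "\<Sum>n\<in>F. scaleC (dmono s n) (c n)"
    have "?P \<in> K" using norm_dmono_le_1[OF s] F(2) by (intro K(2)) auto
    then obtain x where x: "x \<in> k" "dist x ?P < e / 4" using k(2) by auto
    have "dist ?P (f s) \<le> e / 4"
      using dir_bounded_norm_le[OF w h s] by (simp add: dist_norm norm_minus_commute)
    hence "dist x (f s) \<le> e / 2" using x(2) dist_triangle[of x "f s" ?P] by simp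
    with x(1) show "f s \<in> (\<Union>x\<in>k. cball x (e / 2))" by auto
  qed
  hence "closure (f ` right_half_plane) \<subseteq> (\<Union>x\<in>k. cball x (e / 2))"
    by (rule closure_minimal) (use k(1) in auto)
  also have "\<dots> \<subseteq> (\<Union>x\<in>k. ball x e)" using e by (intro UN_mono) auto
  finally show "\<exists>k. finite k \<and> closure (f ` right_half_plane) \<subseteq> (\<Union>x\<in>k. ball x e)"
    using k(1) by blast
qed

section \<open>Horizontal translates\<close>

lemma has_sum_minus:
  fixes f g :: "'i \<Rightarrow> 'a::topological_ab_group_add"
  assumes "(f has_sum a) A" "(g has_sum b) A"
  shows "((\<lambda>x. f x - g x) has_sum (a - b)) A"
  using has_sum_add[OF assms(1), of "\<lambda>x. - g x" "- b"] assms(2) by (simp add: has_sum_uminus)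

text \<open>Dominated convergence along a filter: the tail is small uniformly in \<open>x\<close>
  because \<open>u x n \<le> 1\<close>, and the finite part tends to 0. It serves both small
  translations and translations to infinity.\<close>

lemma eventually_weighted_sum_less:
  fixes b :: "'i \<Rightarrow> real" and u :: "'x \<Rightarrow> 'i \<Rightarrow> real"
  assumes b: "(b has_sum S) A" "\<And>n. n \<in> A \<Longrightarrow> b n \<ge> 0"
    and u: "eventually (\<lambda>x. \<forall>n\<in>A. 0 \<le> u x n \<and> u x n \<le> 1) Fl"
    and lim: "\<And>n. n \<in> A \<Longrightarrow> ((\<lambda>x. u x n) \<longlongrightarrow> 0) Fl" and \<epsilon>: "\<epsilon> > 0"
  shows "eventually (\<lambda>x. \<exists>T. ((\<lambda>n. b n * u x n) has_sum T) A \<and> T \<le> \<epsilon>) Fl"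
proof -
  obtain F where F: "finite F" "F \<subseteq> A" "dist (sum b F) S \<le> \<epsilon> / 2"
    using has_sum_finite_approximation[OF b(1), of "\<epsilon> / 2"] \<epsilon> by auto
  have tail: "(b has_sum (S - sum b F)) (A - F)"
    by (rule has_sum_Diff[OF b(1) has_sum_finite[OF F(1)] F(2)])
  have "((\<lambda>x. \<Sum>n\<in>F. b n * u x n) \<longlongrightarrow> (\<Sum>n\<in>F. b n * 0)) Fl"
    using F(2) by (intro tendsto_sum tendsto_mult_left lim) auto
  hence "eventually (\<lambda>x. (\<Sum>n\<in>F. b n * u x n) < \<epsilon> / 2) Fl"
    using \<epsilon> by (intro order_tendstoD(2)) auto
  with u show ?thesis
  proof eventually_elim
    case (elim x)
    obtain T where T: "((\<lambda>n. b n * u x n) has_sum T) (A - F)" "T \<le> S - sum b F"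
      by (rule has_sum_comparison[OF tail, of "\<lambda>n. b n * u x n"])
        (use elim(1) b(2) in \<open>auto intro: mult_left_le\<close>)
    have "((\<lambda>n. b n * u x n) has_sum ((\<Sum>n\<in>F. b n * u x n) + T)) (F \<union> (A - F))"
      by (rule has_sum_Un_disjoint[OF has_sum_finite[OF F(1)] T(1)]) auto
    moreover have "F \<union> (A - F) = A" using F(2) by blast
    moreover have "(\<Sum>n\<in>F. b n * u x n) + T \<le> \<epsilon>"
      using elim(2) T(2) F(3) unfolding dist_real_def by linarith
    ultimately show ?case by auto
  qed
qed

text \<open>Translating \<open>f\<close> multiplies its coefficients by scalars; this turns a real
  majorant of the scalars into a norm bound for differences of translates.\<close>

lemma dir_bounded_multiplier:
  fixes c :: "nat \<Rightarrow> 'a::comm_complex_banach_algebra_1"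
  assumes w: "weight_on_N \<omega>"
    and T: "((\<lambda>n. (norm (c n) * \<omega> n) * u n) has_sum T) {1..}" "T \<le> \<epsilon>"
    and z: "\<And>n. n \<ge> 1 \<Longrightarrow> cmod (z n) \<le> u n"
    and g: "\<And>s. s \<in> right_half_plane \<Longrightarrow> ((\<lambda>n. scaleC (dmono s n * z n) (c n)) has_sum g s) {1..}"
  shows "dir_bounded \<omega> \<epsilon> g"
proof (rule dir_boundedI[OF w, where I = "{1..}" and m = "\<lambda>n. n" and a = "\<lambda>n. scaleC (z n) (c n)", OF _ T])
  fix n :: nat assume n: "n \<in> {1..}"
  have "cmod (z n) * (norm (c n) * \<omega> n) \<le> u n * (norm (c n) * \<omega> n)"
    using z[of n] weight_ge_1[OF w, of n] n by (intro mult_right_mono) auto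
  thus "norm (scaleC (z n) (c n)) * \<omega> n \<le> norm (c n) * \<omega> n * u n"
    by (simp add: norm_scaleC mult_ac)
qed (use g in \<open>auto simp: scaleC_scaleC\<close>)

text \<open>Uniform continuity of the path of translates: one \<open>\<delta>\<close> works for
  every \<open>\<sigma>\<close>, because the multiplier is
  \<open>1 - dmono (of_real \<delta>) n\<close> up to a factor of modulus at most 1.\<close>

lemma translate_close:
  fixes f :: "complex \<Rightarrow> 'a::comm_complex_banach_algebra_1"
  assumes w: "weight_on_N \<omega>" and f: "dir_bounded \<omega> B f" and \<epsilon>: "\<epsilon> > 0"
  shows "\<exists>\<delta>>0. \<forall>\<sigma>\<ge>0. dir_bounded \<omega> \<epsilon> (\<lambda>s. f (s + of_real (\<sigma> + \<delta>)) - f (s + of_real \<sigma>))"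
proof -
  obtain c S where c: "((\<lambda>n. norm (c n) * \<omega> n) has_sum S) {1..}" "S \<le> B"
    "\<And>s. s \<in> right_half_plane \<Longrightarrow> ((\<lambda>n. scaleC (dmono s n) (c n)) has_sum f s) {1..}"
    using dir_boundedE[OF f] by metis
  define u where "u \<delta> n = 1 - real n powr (- \<delta>)" for \<delta> n
  have u01: "0 \<le> u \<delta> n" "u \<delta> n \<le> 1" if "\<delta> \<ge> 0" "n \<ge> 1" for \<delta> n
    using that powr_mono[of "- \<delta>" 0 "real n"] by (auto simp: u_def)
  have "eventually (\<lambda>\<delta>. \<exists>T. ((\<lambda>n. (norm (c n) * \<omega> n) * u \<delta> n) has_sum T) {1..} \<and> T \<le> \<epsilon>) (at_right 0)"
  proof (rule eventually_weighted_sum_less[OF c(1) _ _ _ \<epsilon>])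
    show "norm (c n) * \<omega> n \<ge> 0" if "n \<in> {1..}" for n
      using weight_ge_1[OF w, of n] that by simp
    show "\<forall>\<^sub>F \<delta> in at_right 0. \<forall>n\<in>{1..}. 0 \<le> u \<delta> n \<and> u \<delta> n \<le> 1"
      using eventually_at_right_less[of "0::real"] by eventually_elim (use u01 in auto)
    show "((\<lambda>\<delta>. u \<delta> n) \<longlongrightarrow> 0) (at_right 0)" if "n \<in> {1..}" for n
    proof -
      have "((\<lambda>\<delta>. 1 - real n powr (- \<delta>)) \<longlongrightarrow> 1 - real n powr (- 0)) (at_right 0)"
        using that by (intro tendsto_intros) auto
      thus ?thesis using that by (simp add: u_def)
    qed
  qed
  moreover note eventually_at_right_less[of "0::real"]
  ultimately have "eventually (\<lambda>\<delta>. (\<exists>T. ((\<lambda>n. (norm (c n) * \<omega> n) * u \<delta> n) has_sum T) {1..} \<and> T \<le> \<epsilon>)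
      \<and> 0 < \<delta>) (at_right 0)" by (rule eventually_conj)
  from eventually_happens[OF this] obtain \<delta> T where \<delta>: "\<delta> > 0"
    and T: "((\<lambda>n. (norm (c n) * \<omega> n) * u \<delta> n) has_sum T) {1..}" "T \<le> \<epsilon>" by auto
  have "dir_bounded \<omega> \<epsilon> (\<lambda>s. f (s + of_real (\<sigma> + \<delta>)) - f (s + of_real \<sigma>))" if \<sigma>: "\<sigma> \<ge> 0" for \<sigma>
  proof (rule dir_bounded_multiplier[OF w T])
    fix n :: nat assume n: "n \<ge> 1"
    have "dmono (of_real (\<sigma> + \<delta>)) n - dmono (of_real \<sigma>) n
        = - (dmono (of_real \<sigma>) n * (1 - dmono (of_real \<delta>) n))"
      using dmono_add[where s = "of_real \<sigma>" and t = "of_real \<delta>" and n = n] by (simp add: algebra_simps)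
    moreover have "1 - dmono (of_real \<delta>) n = of_real (u \<delta> n)"
      using powr_of_real[of "real n" "- \<delta>"] by (simp add: u_def)
    moreover have "cmod (dmono (of_real \<sigma>) n) \<le> 1"
      using norm_dmono_le_1[of "of_real \<sigma>" n] \<sigma> n by (simp add: right_half_plane_def)
    ultimately show "cmod (dmono (of_real (\<sigma> + \<delta>)) n - dmono (of_real \<sigma>) n) \<le> u \<delta> n"
      using u01[of \<delta> n] \<delta> n by (simp add: norm_mult mult_left_le_one_le del: of_real_add)
  next
    fix s :: complex assume s: "s \<in> right_half_plane"
    have "s + of_real (\<sigma> + \<delta>) \<in> right_half_plane" "s + of_real \<sigma> \<in> right_half_plane"
      using s \<sigma> \<delta> by (auto simp: right_half_plane_def)
    from has_sum_minus[OF c(3)[OF this(1)] c(3)[OF this(2)]]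
    show "((\<lambda>n. scaleC (dmono s n * (dmono (of_real (\<sigma> + \<delta>)) n - dmono (of_real \<sigma>) n)) (c n)) has_sum
        f (s + of_real (\<sigma> + \<delta>)) - f (s + of_real \<sigma>)) {1..}"
      unfolding dmono_add[where s = s] right_diff_distrib scaleC_diff_left .
  qed
  with \<delta> show ?thesis by blast
qed

text \<open>Every monomial except the constant one decays as \<open>\<sigma>\<close> grows, so the
  limit \<open>a\<close> is the first coefficient.\<close>

lemma translate_tendsto_const:
  fixes f :: "complex \<Rightarrow> 'a::comm_complex_banach_algebra_1"
  assumes w: "weight_on_N \<omega>" and f: "dir_bounded \<omega> B f"
  shows "\<exists>a. \<forall>\<epsilon>>0. eventually (\<lambda>\<sigma>. dir_bounded \<omega> \<epsilon> (\<lambda>s. a - f (s + of_real \<sigma>))) at_top"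
proof -
  obtain c S where c: "((\<lambda>n. norm (c n) * \<omega> n) has_sum S) {1..}" "S \<le> B"
    "\<And>s. s \<in> right_half_plane \<Longrightarrow> ((\<lambda>n. scaleC (dmono s n) (c n)) has_sum f s) {1..}"
    using dir_boundedE[OF f] by metis
  \<comment> \<open>The value 0 at \<open>n = 1\<close> reflects that the constant term cancels in
    \<open>c 1 - f (s + of_real \<sigma>)\<close>.\<close>
  define u where "u \<sigma> n = (if n = 1 then 0 else real n powr (- \<sigma>))" for \<sigma> :: real and n :: nat
  have u01: "0 \<le> u \<sigma> n" "u \<sigma> n \<le> 1" if "\<sigma> \<ge> 0" "n \<ge> 1" for \<sigma> n
    using that powr_mono[of "- \<sigma>" 0 "real n"] by (auto simp: u_def)
  have "eventually (\<lambda>\<sigma>. dir_bounded \<omega> \<epsilon> (\<lambda>s. c 1 - f (s + of_real \<sigma>))) at_top" if \<epsilon>: "\<epsilon> > 0" for \<epsilon>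
  proof -
    have "eventually (\<lambda>\<sigma>. \<exists>T. ((\<lambda>n. (norm (c n) * \<omega> n) * u \<sigma> n) has_sum T) {1..} \<and> T \<le> \<epsilon>) at_top"
    proof (rule eventually_weighted_sum_less[OF c(1) _ _ _ \<epsilon>])
      show "norm (c n) * \<omega> n \<ge> 0" if "n \<in> {1..}" for n
        using weight_ge_1[OF w, of n] that by simp
      show "\<forall>\<^sub>F \<sigma> in at_top. \<forall>n\<in>{1..}. 0 \<le> u \<sigma> n \<and> u \<sigma> n \<le> 1"
        using eventually_ge_at_top[of "0::real"] by eventually_elim (use u01 in auto)
      show "((\<lambda>\<sigma>. u \<sigma> n) \<longlongrightarrow> 0) at_top" if "n \<in> {1..}" for n
      proof (cases "n = 1")
        case False
        with that have n: "real n > 1" by auto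
        hence "((\<lambda>\<sigma>. exp (- (ln (real n) * \<sigma>))) \<longlongrightarrow> 0) at_top"
          by (intro filterlim_compose[OF exp_at_bot] filterlim_compose[OF filterlim_uminus_at_bot_at_top]
              filterlim_tendsto_pos_mult_at_top[OF tendsto_const] filterlim_ident) simp
        thus ?thesis using n False by (simp add: u_def powr_def mult.commute)
      qed (simp add: u_def)
    qed
    with eventually_ge_at_top[of "0::real"] show ?thesis
    proof eventually_elim
      case (elim \<sigma>)
      then obtain T where T: "((\<lambda>n. (norm (c n) * \<omega> n) * u \<sigma> n) has_sum T) {1..}" "T \<le> \<epsilon>" by blast
      show ?case
      proof (rule dir_bounded_multiplier[OF w T])
        show "cmod ((if n = 1 then 1 else 0) - dmono (of_real \<sigma>) n) \<le> u \<sigma> n" if "n \<ge> 1" for n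
          using norm_dmono[OF that, of "of_real \<sigma>"] by (simp add: u_def)
        fix s :: complex assume s: "s \<in> right_half_plane"
        have s\<sigma>: "s + of_real \<sigma> \<in> right_half_plane"
          using s elim(1) by (auto simp: right_half_plane_def)
        have "((\<lambda>n. scaleC (if n = 1 then 1 else 0) (c n)) has_sum c 1) {1..}"
          by (rule has_sum_finite_neutralI[of "{1}"]) (auto simp: scaleC_one)
        from has_sum_minus[OF this c(3)[OF s\<sigma>]]
        have "((\<lambda>n. scaleC ((if n = 1 then 1 else 0) - dmono (s + of_real \<sigma>) n) (c n)) has_sum
            c 1 - f (s + of_real \<sigma>)) {1..}"
          unfolding scaleC_diff_left .
        \<comment> \<open>Pulling out \<open>dmono s n\<close> is harmless for the indicator of
          \<open>n = 1\<close>, since \<open>dmono s 1 = 1\<close>.\<close>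
        moreover have "(if n = 1 then 1 else 0) - dmono (s + of_real \<sigma>) n
            = dmono s n * ((if n = 1 then 1 else 0) - dmono (of_real \<sigma>) n)" for n
          unfolding dmono_add by (simp add: right_diff_distrib)
        ultimately show "((\<lambda>n. scaleC (dmono s n * ((if n = 1 then 1 else 0) - dmono (of_real \<sigma>) n)) (c n))
            has_sum c 1 - f (s + of_real \<sigma>)) {1..}" by simp
      qed
    qed
  qed
  thus ?thesis by blast
qed

section \<open>The invertibility criterion\<close>

text \<open>Weighted summability makes the Dirichlet series absolutely convergent at each point of
  the half-plane, so the infinite sum in the definition is a genuine limit.\<close>

lemma dirichlet_algebra_iff:
  fixes f :: "complex \<Rightarrow> 'a::comm_complex_banach_algebra_1"
  assumes w: "weight_on_N \<omega>"
  shows "f \<in> dirichlet_algebra \<omega> \<longleftrightarrow> (\<exists>B. dir_bounded \<omega> B f)"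
proof
  assume "f \<in> dirichlet_algebra \<omega>"
  then obtain c where c: "(\<lambda>n. norm (c n) * \<omega> n) summable_on {1..}"
    "\<And>s. s \<in> right_half_plane \<Longrightarrow> f s = (\<Sum>\<^sub>\<infinity>n\<in>{1..}. scaleC (dmono s n) (c n))"
    by (auto simp: dirichlet_algebra_def)
  have "((\<lambda>n. scaleC (dmono s n) (c n)) has_sum f s) {1..}" if s: "s \<in> right_half_plane" for s
    unfolding c(2)[OF s]
    by (rule has_sum_infsum, rule abs_summable_summable,
        rule Infinite_Sum.abs_summable_on_comparison_test'[OF c(1)])
      (use norm_scaleC_dmono_le[OF w s] in auto)
  thus "\<exists>B. dir_bounded \<omega> B f" using has_sum_infsum[OF c(1)] unfolding dir_bounded_def by blast
next
  assume "\<exists>B. dir_bounded \<omega> B f"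
  then obtain c S where "((\<lambda>n. norm (c n) * \<omega> n) has_sum S) {1..}"
    "\<And>s. s \<in> right_half_plane \<Longrightarrow> ((\<lambda>n. scaleC (dmono s n) (c n)) has_sum f s) {1..}"
    by (auto elim: dir_boundedE)
  hence "(\<lambda>n. norm (c n) * \<omega> n) summable_on {1..}"
    "\<forall>s\<in>right_half_plane. f s = (\<Sum>\<^sub>\<infinity>n\<in>{1..}. scaleC (dmono s n) (c n))"
    by (blast intro: has_sum_imp_summable infsumI[symmetric])+
  thus "f \<in> dirichlet_algebra \<omega>" unfolding dirichlet_algebra_def by blast
qed

lemma invertible_in_D_iff:
  "weight_on_N \<omega> \<Longrightarrow> invertible_in_D \<omega> f \<longleftrightarrow> dir_invertible \<omega> f"
  unfolding invertible_in_D_def dir_invertible_def by (meson dirichlet_algebra_iff)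

lemma invertible_if_norm_less_1:
  fixes x :: "'a::comm_complex_banach_algebra_1"
  assumes "norm (1 - x) < 1"
  shows "x \<in> invertibles"
proof -
  let ?y = "1 - x"
  have s: "summable (\<lambda>n. ?y ^ n)" by (rule complete_algebra_summable_geometric[OF assms])
  have "(\<lambda>n. ?y ^ n - ?y ^ Suc n) sums (?y ^ 0 - 0)"
    by (rule telescope_sums'[OF summable_LIMSEQ_zero[OF s]])
  moreover have "?y ^ n - ?y ^ Suc n = x * ?y ^ n" for n by (simp add: algebra_simps)
  ultimately have "(\<lambda>n. x * ?y ^ n) sums 1" by simp
  with sums_mult[OF summable_sums[OF s], of x] have "x * (\<Sum>n. ?y ^ n) = 1"
    by (rule sums_unique2)
  thus ?thesis by (auto simp: invertibles_def)
qed

text \<open>An inverse in the algebra is bounded. If \<open>a\<close> is close enough to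
  \<open>f s\<close>, then \<open>1 - a * g s = (f s - a) * g s\<close> has norm below 1, so
  \<open>a * g s\<close> and with it \<open>a\<close> are invertible.\<close>

lemma dir_invertible_imp_closure_invertible:
  fixes f :: "complex \<Rightarrow> 'a::comm_complex_banach_algebra_1"
  assumes w: "weight_on_N \<omega>" and f: "dir_invertible \<omega> f"
  shows "closure (f ` right_half_plane) \<subseteq> invertibles"
proof
  fix a assume a: "a \<in> closure (f ` right_half_plane)"
  obtain B g where g: "dir_bounded \<omega> B g" "\<And>s. s \<in> right_half_plane \<Longrightarrow> f s * g s = 1"
    using f by (auto simp: dir_invertible_def)
  have B: "B \<ge> 0" by (rule dir_bounded_nonneg[OF w g(1)])
  obtain s where s: "s \<in> right_half_plane" "dist (f s) a < 1 / (B + 1)"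
    using a B unfolding closure_approachable by (auto dest!: spec[of _ "1 / (B + 1)"])
  have "norm ((f s - a) * g s) \<le> norm (f s - a) * norm (g s)" by (rule norm_mult_ineq)
  also have "\<dots> \<le> 1 / (B + 1) * B"
    using s dir_bounded_norm_le[OF w g(1) s(1)] B by (intro mult_mono) (auto simp: dist_norm)
  also have "\<dots> < 1" using B by simp
  finally have "norm (1 - a * g s) < 1" by (simp add: g(2)[OF s(1)] left_diff_distrib)
  from invertible_if_norm_less_1[OF this] obtain y where "(a * g s) * y = 1"
    by (auto simp: invertibles_def)
  thus "a \<in> invertibles" unfolding invertibles_def by (auto simp: mult.assoc)
qed

lemma dir_invertible_if_closure_invertible:
  fixes f :: "complex \<Rightarrow> 'a::comm_complex_banach_algebra_1"
  assumes \<omega>: "admissible_weight \<omega>" and f: "dir_bounded \<omega> B f"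
    and inv: "closure (f ` right_half_plane) \<subseteq> invertibles"
  shows "dir_invertible \<omega> f"
proof -
  have w: "weight_on_N \<omega>" using \<omega> by (simp add: admissible_weight_def)
  let ?K = "closure (f ` right_half_plane)"
  obtain M where M: "\<And>x y. x \<in> ?K \<Longrightarrow> x * y = 1 \<Longrightarrow> norm y \<le> M"
    using compact_inverses_bounded[OF compact_closure_range[OF w f] inv] by blast
  have fK: "f s \<in> ?K" if "s \<in> right_half_plane" for s
    using that by (intro subsetD[OF closure_subset] imageI)
  have f0: "f 0 \<in> ?K" by (rule fK) (simp add: right_half_plane_def)
  then obtain y where "f 0 * y = 1" using inv by (auto simp: invertibles_def)
  with f0 have "norm y \<le> M" by (rule M)
  hence M0: "M \<ge> 0" using norm_ge_zero order_trans by blast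
  define \<eta> where "\<eta> = 1 / (2 * (M + 1))"
  have \<eta>: "\<eta> > 0" "\<eta> * (M + 1) < 1" using M0 by (auto simp: \<eta>_def)
  \<comment> \<open>One step along the path. The same \<open>\<eta>\<close> serves every step, since
    all functions involved take values in \<open>?K\<close>, where \<open>M\<close> bounds all
    inverses.\<close>
  have close_inv: "dir_invertible \<omega> g'" if g: "dir_invertible \<omega> g" "\<And>s. s \<in> right_half_plane \<Longrightarrow> g s \<in> ?K"
    and gg': "dir_bounded \<omega> \<eta> (\<lambda>s. g s - g' s)" for g g' :: "complex \<Rightarrow> 'a"
  proof -
    obtain C h where h: "dir_bounded \<omega> C h" "\<And>s. s \<in> right_half_plane \<Longrightarrow> g s * h s = 1"
      using g(1) by (auto simp: dir_invertible_def)
    show ?thesis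
      by (rule dir_invertible_perturb[OF \<omega> h M[OF g(2) h(2)] gg' \<eta>(2)])
  qed
  obtain a where a: "\<And>\<epsilon>. \<epsilon> > 0 \<Longrightarrow>
      eventually (\<lambda>\<sigma>. dir_bounded \<omega> \<epsilon> (\<lambda>s. a - f (s + of_real \<sigma>))) at_top"
    using translate_tendsto_const[OF w f] by blast
  \<comment> \<open>The endpoint is a limit of the values \<open>f (of_real \<sigma>)\<close>; it
    need not be a value of \<open>f\<close>, so the hypothesis on the closure is what makes it
    invertible.\<close>
  have "a \<in> ?K"
    unfolding closure_approachable
  proof (intro allI impI)
    fix e :: real assume e: "e > 0"
    have "eventually (\<lambda>\<sigma>::real. \<sigma> \<ge> 0 \<and> dir_bounded \<omega> (e / 2) (\<lambda>s. a - f (s + of_real \<sigma>))) at_top"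
      using a[of "e / 2"] e by (intro eventually_conj eventually_ge_at_top) simp
    from eventually_happens[OF this] obtain \<sigma> :: real where \<sigma>: "\<sigma> \<ge> 0"
      "dir_bounded \<omega> (e / 2) (\<lambda>s. a - f (s + of_real \<sigma>))" by auto
    have "norm (a - f (0 + of_real \<sigma>)) \<le> e / 2"
      by (rule dir_bounded_norm_le[OF w \<sigma>(2)]) (simp add: right_half_plane_def)
    hence "dist (f (of_real \<sigma>)) a < e" using e by (simp add: dist_norm norm_minus_commute)
    moreover have "of_real \<sigma> \<in> right_half_plane" using \<sigma>(1) by (simp add: right_half_plane_def)
    ultimately show "\<exists>y\<in>f ` right_half_plane. dist y a < e" by blast
  qed
  obtain b where "a * b = 1" using \<open>a \<in> ?K\<close> inv by (auto simp: invertibles_def)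
  hence a_inv: "dir_invertible \<omega> (\<lambda>_. a)"
    using dir_bounded_const[OF w, of b] by (auto simp: dir_invertible_def)
  obtain \<delta> :: real where \<delta>: "\<delta> > 0"
    "\<And>\<sigma>. \<sigma> \<ge> 0 \<Longrightarrow> dir_bounded \<omega> \<eta> (\<lambda>s. f (s + of_real (\<sigma> + \<delta>)) - f (s + of_real \<sigma>))"
    using translate_close[OF w f \<eta>(1)] by blast
  obtain \<sigma>0 where \<sigma>0: "\<And>\<sigma>. \<sigma> \<ge> \<sigma>0 \<Longrightarrow> dir_bounded \<omega> \<eta> (\<lambda>s. a - f (s + of_real \<sigma>))"
    using a[OF \<eta>(1)] unfolding eventually_at_top_linorder by blast
  obtain N :: nat where N: "\<sigma>0 < real N * \<delta>" using reals_Archimedean3[OF \<delta>(1)] by blast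
  \<comment> \<open>Downward induction from \<open>N\<close> to 0: the constant \<open>a\<close>
    reaches the translate by \<open>N * \<delta>\<close> in one step, and each further step shortens
    the translation by \<open>\<delta>\<close>.\<close>
  have "dir_invertible \<omega> (\<lambda>s. f (s + of_real (real k * \<delta>)))" if "k \<le> N" for k
    using that
  proof (induction k rule: inc_induct)
    case base
    show ?case
      by (rule close_inv[OF a_inv \<open>a \<in> ?K\<close>]) (rule \<sigma>0[OF less_imp_le[OF N]])
  next
    case (step k)
    have k: "real (Suc k) * \<delta> = real k * \<delta> + \<delta>" by (simp add: algebra_simps)
    show ?case
    proof (rule close_inv[OF step.IH])
      fix s :: complex assume "s \<in> right_half_plane"
      hence "s + of_real (real (Suc k) * \<delta>) \<in> right_half_plane"
        using \<delta>(1) by (simp add: right_half_plane_def)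
      thus "f (s + of_real (real (Suc k) * \<delta>)) \<in> ?K" by (rule fK)
    next
      show "dir_bounded \<omega> \<eta> (\<lambda>s. f (s + of_real (real (Suc k) * \<delta>)) - f (s + of_real (real k * \<delta>)))"
        unfolding k using \<delta> by (intro \<delta>(2)) simp
    qed
  qed
  from this[of 0] show ?thesis by simp
qed

theorem mainTheorem3:
  fixes \<omega> :: "nat \<Rightarrow> real" and f :: "complex \<Rightarrow> 'a::comm_complex_banach_algebra_1"
  assumes "admissible_weight \<omega>"
    and "f \<in> dirichlet_algebra \<omega>"
  shows "invertible_in_D \<omega> f \<longleftrightarrow> closure (f ` right_half_plane) \<subseteq> invertibles"
proof -
  have w: "weight_on_N \<omega>" using assms(1) by (simp add: admissible_weight_def)
  obtain B where B: "dir_bounded \<omega> B f" using assms(2) by (auto simp: dirichlet_algebra_iff[OF w])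
  show ?thesis
    unfolding invertible_in_D_iff[OF w]
    using dir_invertible_imp_closure_invertible[OF w]
      dir_invertible_if_closure_invertible[OF assms(1) B] by blast
qed

end
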